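(* Let $d\geq 3$ and $N\in\mathbb{N}_{>0}$, and let $\langle\varphi_o\cdot\varphi_z\rangle_{L,N,\beta}$ be the spin-spin correlation of the spin $O(N)$ model on the $d$-dimensional torus of side length $L$ at inverse temperature $\beta$. Then there exists $\beta_0'<\infty$ such that if $\beta>\beta_0'$, there exist $C=C(\beta,d,N)>0$ and $L_0<\infty$ such that for every even $L>L_0$, $$\langle\varphi_o\cdot\varphi_z\rangle_{L,N,\beta}\geq C\qquad\text{for all } z\in\mathbb{T}_L \text{ with } \|z\|_\infty<\tfrac{L}{8}.$$
   Context: The torus is $\mathbb{T}_L=\mathbb{Z}^d/L\mathbb{Z}^d$ with nearest-neighbour edges $\mathcal{E}_L$; $o=(0,\dots,0)$; $\|z\|_\infty$ is taken with respect to the torus metric, i.e. $\|z\|_\infty=\max_i \min_{k\in\mathbb{Z}}|z_i+kL|$. Spin $O(N)$ model. Spin configurations are $\varphi=(\varphi_x)_{x\in\mathbb{T}_L}\in(\mathbb{S}^{N-1})^{\mathbb{T}_L}$, where $\mathbb{S}^{N-1}\subset\mathbb{R}^N$ is the unit sphere ($\mathbb{S}^0=\{-1,1\}$). With $H(\varphi)=-\sum_{\{x,y\}\in\mathcal{E}_L}\varphi_x\cdot\varphi_y$ and $d\varphi_x$ the uniform probability measure on $\mathbb{S}^{N-1}$, define $$\langle f\rangle_{L,N,\beta}=\frac{\big(\prod_{x\in\mathbb{T}_L}\int_{\mathbb{S}^{N-1}}d\varphi_x\big)f(\varphi)e^{-\beta H(\varphi)}}{\big(\prod_{x\in\mathbb{T}_L}\int_{\mathbb{S}^{N-1}}d\varphi_x\big)e^{-\beta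 H(\varphi)}}.$$ *)

theory Defs
  imports "HOL-Probability.Probability"
begin

type_synonym site = "nat \<Rightarrow> int"

text \<open>
  A class in \<open>\<int>\<^sup>d / L\<int>\<^sup>d\<close> is represented by its unique representative with all coordinates in
  \<open>{0..<L}\<close>; coordinates are indexed by \<open>{..<d}\<close>.
\<close>

definition torus :: "nat \<Rightarrow> nat \<Rightarrow> site set" where
  "torus d L = (\<Pi>\<^sub>E i\<in>{..<d}. {0..<int L})"

definition origin :: "nat \<Rightarrow> site" where
  "origin d = (\<lambda>i\<in>{..<d}. 0)"

text \<open>
  Edges are unordered pairs, so for \<open>L = 2\<close> the two parallel edges between neighbours are identified.
\<close>

definition torus_edges :: "nat \<Rightarrow> nat \<Rightarrow> site set set" where
  "torus_edges d L = {{x, x(i := (x i + 1) mod int L)} | x i. x \<in> torus d L \<and> i < d}"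

definition torus_norm :: "nat \<Rightarrow> nat \<Rightarrow> site \<Rightarrow> int" where
  "torus_norm d L z = (MAX i\<in>{..<d}. INF k. \<bar>z i + k * int L\<bar>)"

text \<open>The infimum over \<open>k\<close> is attained, so it is the minimum.\<close>

lemma torus_norm_coordinate_attained:
  fixes a b :: int
  shows "\<exists>k. (INF k. \<bar>a + k * b\<bar>) = \<bar>a + k * b\<bar>"
proof -
  let ?X = "range (\<lambda>k. \<bar>a + k * b\<bar>)"
  have bdd: "bdd_below ?X"
    by (rule bdd_belowI[of _ 0]) auto
  have "Inf ?X < Inf ?X + 1"
    by simp
  then obtain y where y: "y \<in> ?X" "y < Inf ?X + 1"
    using cInf_lessD[of ?X "Inf ?X + 1"] by blast
  moreover have "Inf ?X \<le> y"
    using y(1) bdd by (rule cInf_lower)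
  ultimately have "Inf ?X \<in> ?X"
    by (metis zless_add1_eq order_antisym_conv linorder_not_less)
  then show ?thesis
    by auto
qed

text \<open>
  The uniform probability measure on \<open>\<S>\<^sup>N\<^sup>-\<^sup>1 \<subseteq> \<real>\<^sup>N\<close>, with \<open>N = CARD('n)\<close>, i.e. the normalised surface
  measure: the push-forward of the uniform distribution on the unit ball under the radial
  projection \<open>sgn x = x /\<^sub>R norm x\<close>, as a measure on the sphere. (The origin, where \<open>sgn\<close>
  vanishes, is a null set.) For \<open>N = 1\<close> this is the fair coin on \<open>{-1, 1}\<close>.
\<close>

definition sphere_measure :: "(real ^ 'n) measure" where
  "sphere_measure =
     restrict_space (distr (uniform_measure lborel (ball 0 1)) borel sgn) (sphere 0 1)"

lemma space_sphere_measure: "space sphere_measure = sphere 0 1"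
  by (simp add: sphere_measure_def space_restrict_space)

lemma sets_sphere_measure: "sets sphere_measure = sets (restrict_space borel (sphere 0 1))"
  unfolding sphere_measure_def by (rule sets_restrict_space_cong) simp

lemma prob_space_sphere_measure: "prob_space (sphere_measure :: (real ^ 'n) measure)"
proof -
  let ?U = "uniform_measure lborel (ball 0 1 :: (real ^ 'n) set)"
  have pos: "emeasure lborel (ball 0 1 :: (real ^ 'n) set) \<noteq> 0"
    using content_ball_pos[of 1 "0 :: real ^ 'n"] by (auto simp: measure_def)
  have fin: "emeasure lborel (ball 0 1 :: (real ^ 'n) set) \<noteq> \<infinity>"
    using emeasure_bounded_finite[of "ball 0 1 :: (real ^ 'n) set"] by simp
  interpret U: prob_space ?U
    by (rule prob_space_uniform_measure[OF pos fin])
  interpret D: prob_space "distr ?U borel sgn"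
    by (rule U.prob_space_distr) simp
  have "AE x in ?U. sgn x \<in> sphere 0 1"
  proof -
    have "AE x in lborel. x \<noteq> (0 :: real ^ 'n)"
      by (rule AE_lborel_singleton)
    then have "AE x in ?U. x \<noteq> 0"
      by (intro AE_uniform_measureI) (auto elim: eventually_mono)
    then show ?thesis
      by eventually_elim (simp add: norm_sgn)
  qed
  then have "AE x in distr ?U borel sgn. x \<in> sphere 0 1"
    by (subst AE_distr_iff) auto
  then have "emeasure (distr ?U borel sgn) (sphere 0 1) = 1"
    by (intro D.emeasure_eq_1_AE) auto
  then show ?thesis
    unfolding sphere_measure_def
    by (intro prob_spaceI) (simp add: space_restrict_space emeasure_restrict_space)
qed

type_synonym 'n spin_config = "site \<Rightarrow> real ^ 'n"

text \<open>The value \<open>\<phi> x \<bullet> \<phi> y\<close> on the edge \<open>{x, y}\<close>; by symmetry it does not depend on the orientation.\<close>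

definition edge_inner :: "'n::finite spin_config \<Rightarrow> site set \<Rightarrow> real" where
  "edge_inner \<phi> e = (THE r. \<exists>x y. e = {x, y} \<and> r = \<phi> x \<bullet> \<phi> y)"

lemma edge_inner_doubleton [simp]: "edge_inner \<phi> {x, y} = \<phi> x \<bullet> \<phi> y"
  unfolding edge_inner_def
  by (rule the_equality) (auto simp: doubleton_eq_iff inner_commute)

definition hamiltonian :: "nat \<Rightarrow> nat \<Rightarrow> 'n::finite spin_config \<Rightarrow> real" where
  "hamiltonian d L \<phi> = - (\<Sum>e\<in>torus_edges d L. edge_inner \<phi> e)"

definition spin_measure :: "nat \<Rightarrow> nat \<Rightarrow> 'n::finite spin_config measure" where
  "spin_measure d L = (\<Pi>\<^sub>M x\<in>torus d L. sphere_measure)"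

definition spin_expectation :: "nat \<Rightarrow> nat \<Rightarrow> real \<Rightarrow> ('n::finite spin_config \<Rightarrow> real) \<Rightarrow> real" where
  "spin_expectation d L \<beta> f =
     (\<integral>\<phi>. f \<phi> * exp (- \<beta> * hamiltonian d L \<phi>) \<partial>spin_measure d L) /
     (\<integral>\<phi>. exp (- \<beta> * hamiltonian d L \<phi>) \<partial>(spin_measure d L :: 'n spin_config measure))"

end

theory Submission
  imports Defs
begin

text \<open>
  The mechanism is the infrared bound of Froehlich, Simon and Spencer, used in real space.
  On spins of length one \<open>- \<beta> H\<close> equals \<open>- \<beta> / 4\<close> times the sum of \<open>\<bar>\<phi>\<^sub>x - \<phi>\<^sub>y\<bar>\<^sup>2\<close> over ordered
  neighbour pairs, up to a constant. Replace each gradient by \<open>\<phi>\<^sub>x - \<phi>\<^sub>y + h(x, y)\<close>, with an arbitrary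
  vector \<open>h(x, y)\<close> on every ordered pair. A Gaussian factor that couples two mirror halves of the torus is
  an integral of products of functions of the two halves, so Cauchy-Schwarz bounds the square of
  the shifted partition function by the product of two others, in which \<open>h\<close> has been
  symmetrised and set to \<open>0\<close> on the bonds that cross the mirror
  (\<open>reflection_positivity\<close>). Among the fields with values in a fixed finite set, a maximiser with as
  few nonzero bonds as possible must therefore vanish, which is \<open>gaussian_domination\<close>. Expanding in
  the size of \<open>h\<close> gives \<open>infrared_bound\<close>: the mean square of \<open>\<Sum> (\<phi>\<^sub>x - \<phi>\<^sub>y) \<bullet> h(x, y)\<close> is at most
  a constant times \<open>\<Sum> \<bar>h\<bar>\<^sup>2 / \<beta>\<close>, uniformly in \<open>L\<close>.

  Since \<open>h\<close> is arbitrary, it may live on the bonds that leave a chosen set in one direction. Averaged over a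
  set of \<open>n\<close> sites, a one-step difference \<open>\<phi>\<^sub>x - \<phi>\<^sub>y\<close> has root mean square of order \<open>1 / sqrt (\<beta> n)\<close>.
  Take cubes of side \<open>2\<^sup>k\<close> that extend in three of the \<open>d\<close> directions. Passing
  from one cube to the next costs \<open>2\<^sup>k\<close> steps of size \<open>8\<^sup>-\<^sup>k\<^sup>/\<^sup>2\<close>, that is \<open>2\<^sup>-\<^sup>k\<^sup>/\<^sup>2\<close>, which is
  summable; here \<open>d \<ge> 3\<close> enters. Moving a cube of side comparable to \<open>L\<close> across the torus costs
  only a bounded number of such units. Hence \<open>\<phi>\<^sub>o\<close> and \<open>\<phi>\<^sub>z\<close> differ in root mean square by at most
  \<open>K / sqrt \<beta>\<close>, with \<open>K\<close> independent of \<open>L\<close> and of \<open>z\<close> (\<open>spin_difference_mean_square\<close>), and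
  \<open>\<langle>\<phi>\<^sub>o \<bullet> \<phi>\<^sub>z\<rangle> = 1 - \<langle>\<bar>\<phi>\<^sub>o - \<phi>\<^sub>z\<bar>\<^sup>2\<rangle> / 2\<close> is at least \<open>1 / 2\<close> for large \<open>\<beta>\<close>.
\<close>

section \<open>Gaussian couplings of two copies of a space\<close>

lemma gaussian_convolution:
  fixes k p q :: real
  assumes "0 < k"
  shows "(\<integral>\<^sup>+t. ennreal (exp (- (2 * k) * (p - t)\<^sup>2)) * ennreal (exp (- (2 * k) * (q - t)\<^sup>2)) \<partial>lborel)
    = ennreal (sqrt (pi / (4 * k))) * ennreal (exp (- k * (p - q)\<^sup>2))"
proof -
  define s where "s = sqrt (1 / (8 * k))"
  have s: "0 < s" "s\<^sup>2 = 1 / (8 * k)" using assms by (auto simp: s_def)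
  have "exp (- (2 * k) * (p - t)\<^sup>2) * exp (- (2 * k) * (q - t)\<^sup>2)
      = (sqrt (pi / (4 * k)) * exp (- k * (p - q)\<^sup>2)) * normal_density ((p + q) / 2) s t" for t
  proof -
    have 1: "- (2 * k) * (p - t)\<^sup>2 + - (2 * k) * (q - t)\<^sup>2
        = - k * (p - q)\<^sup>2 + - ((t - (p + q) / 2)\<^sup>2 / (2 * s\<^sup>2))"
      using assms unfolding s by (simp add: field_simps power2_eq_square)
    have 2: "2 * pi * s\<^sup>2 = pi / (4 * k)" using s by simp
    have "sqrt (pi / (4 * k)) \<noteq> 0" using assms by simp
    then show ?thesis
      unfolding normal_density_def 2 by (simp add: mult_exp_exp 1[simplified])
  qed
  then have "(\<integral>\<^sup>+t. ennreal (exp (- (2 * k) * (p - t)\<^sup>2)) * ennreal (exp (- (2 * k) * (q - t)\<^sup>2)) \<partial>lborel)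
    = (\<integral>\<^sup>+t. ennreal (sqrt (pi / (4 * k)) * exp (- k * (p - q)\<^sup>2)) *
         ennreal (normal_density ((p + q) / 2) s t) \<partial>lborel)"
    using assms by (intro nn_integral_cong) (simp add: ennreal_mult'[symmetric])
  also have "\<dots> = ennreal (sqrt (pi / (4 * k)) * exp (- k * (p - q)\<^sup>2))"
    using s by (subst nn_integral_cmult)
      (auto simp: nn_integral_eq_integral integrable_normal_density)
  finally show ?thesis using assms by (simp add: ennreal_mult)
qed

text \<open>
  By \<open>gaussian_convolution\<close> each Gaussian factor \<open>exp (- k (u\<^sub>i x - v\<^sub>i y)\<^sup>2)\<close> is, up to a constant, an integral
  over an auxiliary variable \<open>t\<^sub>i\<close> of a function of \<open>x\<close> times a function of \<open>y\<close>. Fubini then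
  decouples the two copies of \<open>X\<close> at fixed \<open>t\<close>.
\<close>

lemma gaussian_coupling_eq_product_integral:
  fixes X :: "'a measure" and u v :: "'i \<Rightarrow> 'a \<Rightarrow> real" and a b :: "'a \<Rightarrow> ennreal"
  assumes X: "sigma_finite_measure X" and k: "0 < k" and I: "finite I"
    and u[measurable]: "\<And>i. i \<in> I \<Longrightarrow> u i \<in> borel_measurable X"
    and v[measurable]: "\<And>i. i \<in> I \<Longrightarrow> v i \<in> borel_measurable X"
    and a[measurable]: "a \<in> borel_measurable X" and b[measurable]: "b \<in> borel_measurable X"
  shows "ennreal (sqrt (pi / (4 * k))) ^ card I *
      (\<integral>\<^sup>+x. \<integral>\<^sup>+y. a x * b y * (\<Prod>i\<in>I. ennreal (exp (- k * (u i x - v i y)\<^sup>2))) \<partial>X \<partial>X)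
    = (\<integral>\<^sup>+t. (\<integral>\<^sup>+x. a x * (\<Prod>i\<in>I. ennreal (exp (- (2 * k) * (u i x - t i)\<^sup>2))) \<partial>X) *
            (\<integral>\<^sup>+y. b y * (\<Prod>i\<in>I. ennreal (exp (- (2 * k) * (v i y - t i)\<^sup>2))) \<partial>X)
          \<partial>(\<Pi>\<^sub>M i\<in>I. lborel))"
proof -
  let ?T = "\<Pi>\<^sub>M i\<in>I. (lborel :: real measure)"
  let ?g = "\<lambda>p t. ennreal (exp (- (2 * k) * (p - t :: real)\<^sup>2))"
  interpret X: sigma_finite_measure X by fact
  interpret L: product_sigma_finite "\<lambda>_::'i. lborel :: real measure" ..
  interpret T: sigma_finite_measure ?T by (rule L.sigma_finite) (rule I)
  interpret XT: pair_sigma_finite X ?T ..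
  have m1[measurable]: "(\<lambda>(x, t). \<Prod>i\<in>I. ?g (u i x) (t i)) \<in> borel_measurable (X \<Otimes>\<^sub>M ?T)"
    unfolding split_def by measurable
  have m2[measurable]: "(\<lambda>(x, t). \<Prod>i\<in>I. ?g (v i x) (t i)) \<in> borel_measurable (X \<Otimes>\<^sub>M ?T)"
    unfolding split_def by measurable
  have conv: "(\<integral>\<^sup>+t. (\<Prod>i\<in>I. ?g (u i x) (t i)) * (\<Prod>i\<in>I. ?g (v i y) (t i)) \<partial>?T)
      = ennreal (sqrt (pi / (4 * k))) ^ card I * (\<Prod>i\<in>I. ennreal (exp (- k * (u i x - v i y)\<^sup>2)))" for x y
  proof -
    have "(\<integral>\<^sup>+t. (\<Prod>i\<in>I. ?g (u i x) (t i)) * (\<Prod>i\<in>I. ?g (v i y) (t i)) \<partial>?T)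
      = (\<integral>\<^sup>+t. (\<Prod>i\<in>I. (\<lambda>s. ?g (u i x) s * ?g (v i y) s) (t i)) \<partial>?T)"
      by (simp only: prod.distrib)
    also have "\<dots> = (\<Prod>i\<in>I. \<integral>\<^sup>+s. ?g (u i x) s * ?g (v i y) s \<partial>lborel)"
      by (rule L.product_nn_integral_prod[OF I]) measurable
    also have "\<dots> = (\<Prod>i\<in>I. ennreal (sqrt (pi / (4 * k))) * ennreal (exp (- k * (u i x - v i y)\<^sup>2)))"
      using gaussian_convolution[OF k] by (intro prod.cong) auto
    finally show ?thesis by (simp add: prod.distrib)
  qed
  have m3[measurable]: "(\<lambda>(x, t). a x * (\<Prod>i\<in>I. ?g (u i x) (t i)) * (\<integral>\<^sup>+y. b y * (\<Prod>i\<in>I. ?g (v i y) (t i)) \<partial>X))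
      \<in> borel_measurable (X \<Otimes>\<^sub>M ?T)"
    unfolding split_def by measurable
  have "(\<integral>\<^sup>+t. (\<integral>\<^sup>+x. a x * (\<Prod>i\<in>I. ?g (u i x) (t i)) \<partial>X) * (\<integral>\<^sup>+y. b y * (\<Prod>i\<in>I. ?g (v i y) (t i)) \<partial>X) \<partial>?T)
    = (\<integral>\<^sup>+t. \<integral>\<^sup>+x. a x * (\<Prod>i\<in>I. ?g (u i x) (t i)) * (\<integral>\<^sup>+y. b y * (\<Prod>i\<in>I. ?g (v i y) (t i)) \<partial>X) \<partial>X \<partial>?T)"
    by (intro nn_integral_cong nn_integral_multc[symmetric]) measurable
  also have "\<dots> = (\<integral>\<^sup>+x. \<integral>\<^sup>+t. a x * (\<Prod>i\<in>I. ?g (u i x) (t i)) * (\<integral>\<^sup>+y. b y * (\<Prod>i\<in>I. ?g (v i y) (t i)) \<partial>X) \<partial>?T \<partial>X)"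
    by (rule XT.Fubini') (rule m3)
  also have "\<dots> = (\<integral>\<^sup>+x. \<integral>\<^sup>+t. \<integral>\<^sup>+y. a x * b y * ((\<Prod>i\<in>I. ?g (u i x) (t i)) * (\<Prod>i\<in>I. ?g (v i y) (t i))) \<partial>X \<partial>?T \<partial>X)"
    by (intro nn_integral_cong, subst nn_integral_cmult[symmetric]) (measurable, simp add: mult_ac)
  also have "\<dots> = (\<integral>\<^sup>+x. \<integral>\<^sup>+y. \<integral>\<^sup>+t. a x * b y * ((\<Prod>i\<in>I. ?g (u i x) (t i)) * (\<Prod>i\<in>I. ?g (v i y) (t i))) \<partial>?T \<partial>X \<partial>X)"
    by (intro nn_integral_cong XT.Fubini') measurable
  also have "\<dots> = (\<integral>\<^sup>+x. \<integral>\<^sup>+y. a x * b y *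
      (ennreal (sqrt (pi / (4 * k))) ^ card I * (\<Prod>i\<in>I. ennreal (exp (- k * (u i x - v i y)\<^sup>2)))) \<partial>X \<partial>X)"
    by (intro nn_integral_cong, subst nn_integral_cmult) (measurable, simp only: conv)
  also have "\<dots> = (\<integral>\<^sup>+x. \<integral>\<^sup>+y. ennreal (sqrt (pi / (4 * k))) ^ card I *
      (a x * b y * (\<Prod>i\<in>I. ennreal (exp (- k * (u i x - v i y)\<^sup>2)))) \<partial>X \<partial>X)"
    by (simp only: mult_ac)
  also have "\<dots> = ennreal (sqrt (pi / (4 * k))) ^ card I *
      (\<integral>\<^sup>+x. \<integral>\<^sup>+y. a x * b y * (\<Prod>i\<in>I. ennreal (exp (- k * (u i x - v i y)\<^sup>2))) \<partial>X \<partial>X)"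
  proof -
    have "(\<integral>\<^sup>+y. ennreal (sqrt (pi / (4 * k))) ^ card I *
      (a x * b y * (\<Prod>i\<in>I. ennreal (exp (- k * (u i x - v i y)\<^sup>2)))) \<partial>X) =
      ennreal (sqrt (pi / (4 * k))) ^ card I *
      (\<integral>\<^sup>+y. a x * b y * (\<Prod>i\<in>I. ennreal (exp (- k * (u i x - v i y)\<^sup>2))) \<partial>X)"
      if "x \<in> space X" for x
      by (intro nn_integral_cmult) measurable
    then have "(\<integral>\<^sup>+x. \<integral>\<^sup>+y. ennreal (sqrt (pi / (4 * k))) ^ card I *
      (a x * b y * (\<Prod>i\<in>I. ennreal (exp (- k * (u i x - v i y)\<^sup>2)))) \<partial>X \<partial>X)
      = (\<integral>\<^sup>+x. ennreal (sqrt (pi / (4 * k))) ^ card I *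
      (\<integral>\<^sup>+y. a x * b y * (\<Prod>i\<in>I. ennreal (exp (- k * (u i x - v i y)\<^sup>2))) \<partial>X) \<partial>X)"
      by (intro nn_integral_cong) auto
    also have "\<dots> = ennreal (sqrt (pi / (4 * k))) ^ card I *
      (\<integral>\<^sup>+x. \<integral>\<^sup>+y. a x * b y * (\<Prod>i\<in>I. ennreal (exp (- k * (u i x - v i y)\<^sup>2))) \<partial>X \<partial>X)"
      by (intro nn_integral_cmult) measurable
    finally show ?thesis .
  qed
  finally show ?thesis by simp
qed

text \<open>
  Once the copies are decoupled this is Cauchy-Schwarz in \<open>t\<close>. Keeping \<open>u\<close> and \<open>v\<close> different
  is the point: a shift of the Gaussian, \<open>v\<^sub>i = u\<^sub>i - h\<^sub>i\<close>, disappears from both factors on the right.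
\<close>

lemma gaussian_coupling_Cauchy_Schwarz:
  fixes X :: "'a measure" and u v :: "'i \<Rightarrow> 'a \<Rightarrow> real" and a b :: "'a \<Rightarrow> ennreal"
  assumes X: "sigma_finite_measure X" and k: "0 < k" and I: "finite I"
    and u[measurable]: "\<And>i. i \<in> I \<Longrightarrow> u i \<in> borel_measurable X"
    and v[measurable]: "\<And>i. i \<in> I \<Longrightarrow> v i \<in> borel_measurable X"
    and a[measurable]: "a \<in> borel_measurable X" and b[measurable]: "b \<in> borel_measurable X"
  shows "(\<integral>\<^sup>+x. \<integral>\<^sup>+y. a x * b y * (\<Prod>i\<in>I. ennreal (exp (- k * (u i x - v i y)\<^sup>2))) \<partial>X \<partial>X)\<^sup>2
    \<le> (\<integral>\<^sup>+x. \<integral>\<^sup>+y. a x * a y * (\<Prod>i\<in>I. ennreal (exp (- k * (u i x - u i y)\<^sup>2))) \<partial>X \<partial>X)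
      * (\<integral>\<^sup>+x. \<integral>\<^sup>+y. b x * b y * (\<Prod>i\<in>I. ennreal (exp (- k * (v i x - v i y)\<^sup>2))) \<partial>X \<partial>X)"
    (is "?ab\<^sup>2 \<le> ?aa * ?bb")
proof -
  let ?T = "\<Pi>\<^sub>M i\<in>I. (lborel :: real measure)"
  define c where "c = ennreal (sqrt (pi / (4 * k))) ^ card I"
  have c: "c \<noteq> 0" "c \<noteq> \<infinity>"
    using k by (auto simp: c_def power_eq_top_ennreal)
  define A where "A = (\<lambda>t. \<integral>\<^sup>+x. a x * (\<Prod>i\<in>I. ennreal (exp (- (2 * k) * (u i x - t i)\<^sup>2))) \<partial>X)"
  define B where "B = (\<lambda>t. \<integral>\<^sup>+x. b x * (\<Prod>i\<in>I. ennreal (exp (- (2 * k) * (v i x - t i)\<^sup>2))) \<partial>X)"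
  interpret X: sigma_finite_measure X by fact
  have [measurable]: "A \<in> borel_measurable ?T" "B \<in> borel_measurable ?T"
    unfolding A_def B_def by measurable
  have ab: "c * ?ab = (\<integral>\<^sup>+t. A t * B t \<partial>?T)"
    unfolding A_def B_def c_def
    by (rule gaussian_coupling_eq_product_integral) (use assms in auto)
  have aa: "c * ?aa = (\<integral>\<^sup>+t. (A t)\<^sup>2 \<partial>?T)"
    unfolding A_def c_def power2_eq_square[of "nn_integral X _"]
    by (rule gaussian_coupling_eq_product_integral) (use assms in auto)
  have bb: "c * ?bb = (\<integral>\<^sup>+t. (B t)\<^sup>2 \<partial>?T)"
    unfolding B_def c_def power2_eq_square[of "nn_integral X _"]
    by (rule gaussian_coupling_eq_product_integral) (use assms in auto)
  have "(c * ?ab)\<^sup>2 \<le> (c * ?aa) * (c * ?bb)"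
    unfolding ab aa bb by (rule Cauchy_Schwarz_nn_integral) measurable
  then have "c\<^sup>2 * ?ab\<^sup>2 \<le> c\<^sup>2 * (?aa * ?bb)"
    by (simp add: power2_eq_square mult_ac)
  moreover have "c\<^sup>2 \<noteq> 0" "c\<^sup>2 \<noteq> \<infinity>" using c by (auto simp: power_eq_top_ennreal)
  ultimately show ?thesis
    by (simp add: ennreal_mult_le_mult_iff)
qed

section \<open>Reflection positivity on a graph with bond fields\<close>

text \<open>
  The field \<open>h\<close> is a function of ordered pairs: \<open>(x, y)\<close> and \<open>(y, x)\<close> contribute separate terms.
  A reflection that reverses bonds then acts on \<open>h\<close> without changing signs.
\<close>

definition gradient_energy :: "('v \<times> 'v) set \<Rightarrow> ('v \<times> 'v \<Rightarrow> 'a::euclidean_space) \<Rightarrow> ('v \<Rightarrow> 'a) \<Rightarrow> real" where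
  "gradient_energy E h \<phi> = (\<Sum>(x, y)\<in>E. (norm (\<phi> x - \<phi> y + h (x, y)))\<^sup>2)"

definition shifted_partition ::
    "'a::euclidean_space measure \<Rightarrow> 'v set \<Rightarrow> ('v \<times> 'v) set \<Rightarrow> real \<Rightarrow> ('v \<times> 'v \<Rightarrow> 'a) \<Rightarrow> ennreal" where
  "shifted_partition M V E k h = (\<integral>\<^sup>+\<phi>. ennreal (exp (- k * gradient_energy E h \<phi>)) \<partial>(\<Pi>\<^sub>M x\<in>V. M))"

text \<open>
  A mirror that cuts bonds in their midpoints: \<open>P\<close> is one of the two halves, and every edge
  that crosses the mirror joins a site with its own mirror image.
\<close>

definition bond_reflection :: "'v set \<Rightarrow> ('v \<times> 'v) set \<Rightarrow> 'v set \<Rightarrow> ('v \<Rightarrow> 'v) \<Rightarrow> bool" where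
  "bond_reflection V E P \<theta> \<longleftrightarrow> P \<subseteq> V \<and>
    (\<forall>x\<in>V. \<theta> x \<in> V \<and> \<theta> (\<theta> x) = x \<and> (\<theta> x \<in> P \<longleftrightarrow> x \<notin> P)) \<and>
    (\<forall>(x, y)\<in>E. (\<theta> x, \<theta> y) \<in> E \<and> ((x \<in> P \<longleftrightarrow> y \<notin> P) \<longrightarrow> y = \<theta> x))"

definition symmetrised_field :: "'v set \<Rightarrow> ('v \<Rightarrow> 'v) \<Rightarrow> ('v \<times> 'v \<Rightarrow> 'a::zero) \<Rightarrow> 'v \<times> 'v \<Rightarrow> 'a" where
  "symmetrised_field P \<theta> h = (\<lambda>(x, y). if x \<in> P \<and> y \<in> P then h (x, y)
     else if x \<notin> P \<and> y \<notin> P then h (\<theta> x, \<theta> y) else 0)"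

lemma power2_norm_eq_sum_inner: "(norm (w :: 'a::euclidean_space))\<^sup>2 = (\<Sum>d\<in>Basis. (w \<bullet> d)\<^sup>2)"
  unfolding power2_norm_eq_inner by (subst euclidean_inner) (simp only: power2_eq_square)

lemma gradient_energy_measurable:
  assumes M: "(\<lambda>v. v) \<in> borel_measurable M" and "E \<subseteq> V \<times> V"
  shows "gradient_energy E h \<in> borel_measurable (\<Pi>\<^sub>M x\<in>V. M)"
proof -
  have [measurable]: "(\<lambda>\<phi>. \<phi> x) \<in> borel_measurable (\<Pi>\<^sub>M x\<in>V. M)" if "x \<in> V" for x
    using measurable_compose[OF measurable_component_singleton[OF that] M] .
  have "(\<lambda>\<phi>. \<Sum>e\<in>E. (norm (\<phi> (fst e) - \<phi> (snd e) + h e))\<^sup>2) \<in> borel_measurable (\<Pi>\<^sub>M x\<in>V. M)"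
  proof (rule borel_measurable_sum)
    fix e assume "e \<in> E"
    then have [measurable]: "fst e \<in> V" "snd e \<in> V" using assms(2) by auto
    show "(\<lambda>\<phi>. (norm (\<phi> (fst e) - \<phi> (snd e) + h e))\<^sup>2) \<in> borel_measurable (\<Pi>\<^sub>M x\<in>V. M)"
      by measurable
  qed
  then show ?thesis unfolding gradient_energy_def[abs_def] by (simp add: split_beta)
qed

text \<open>
  Under a product of identical measures, a configuration on \<open>V\<close> is a pair of independent
  configurations on the half \<open>P\<close>, the second of which is read through the mirror.
\<close>

lemma distr_glue_halves:
  assumes M: "prob_space M" and V: "finite V" and PV: "P \<subseteq> V"
    and \<theta>: "\<And>x. x \<in> V \<Longrightarrow> \<theta> x \<in> V" "\<And>x. x \<in> V \<Longrightarrow> \<theta> (\<theta> x) = x" "\<And>x. x \<in> V \<Longrightarrow> \<theta> x \<in> P \<longleftrightarrow> x \<notin> P"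
  defines "J \<equiv> \<lambda>(\<phi>, \<psi>). \<lambda>x\<in>V. if x \<in> P then \<phi> x else \<psi> (\<theta> x)"
  shows "J \<in> measurable ((\<Pi>\<^sub>M x\<in>P. M) \<Otimes>\<^sub>M (\<Pi>\<^sub>M x\<in>P. M)) (\<Pi>\<^sub>M x\<in>V. M)"
    and "distr ((\<Pi>\<^sub>M x\<in>P. M) \<Otimes>\<^sub>M (\<Pi>\<^sub>M x\<in>P. M)) (\<Pi>\<^sub>M x\<in>V. M) J = (\<Pi>\<^sub>M x\<in>V. M)"
proof -
  let ?X = "\<Pi>\<^sub>M x\<in>P. M"
  interpret prob_space M by fact
  interpret product_prob_space "\<lambda>_. M" by standard
  have finP: "finite P" using PV V finite_subset by auto
  interpret X: prob_space ?X by (rule prob_space_PiM) (rule M)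
  show J[measurable]: "J \<in> measurable (?X \<Otimes>\<^sub>M ?X) (\<Pi>\<^sub>M x\<in>V. M)"
    unfolding J_def split_def
  proof (rule measurable_restrict)
    fix x assume x: "x \<in> V"
    show "(\<lambda>p. if x \<in> P then fst p x else snd p (\<theta> x)) \<in> measurable (?X \<Otimes>\<^sub>M ?X) M"
    proof (cases "x \<in> P")
      case True
      then show ?thesis by simp measurable
    next
      case False
      then have "\<theta> x \<in> P" using \<theta> x by auto
      with False show ?thesis by simp measurable
    qed
  qed
  show "distr (?X \<Otimes>\<^sub>M ?X) (\<Pi>\<^sub>M x\<in>V. M) J = (\<Pi>\<^sub>M x\<in>V. M)"
  proof (rule PiM_eqI)
    fix A assume A: "\<And>x. x \<in> V \<Longrightarrow> A x \<in> sets M"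
    have Asp: "A x \<subseteq> space M" if "x \<in> V" for x using A[OF that] sets.sets_into_space by blast
    have pre: "J -` (Pi\<^sub>E V A) \<inter> space (?X \<Otimes>\<^sub>M ?X) = Pi\<^sub>E P A \<times> Pi\<^sub>E P (A \<circ> \<theta>)" (is "?l = ?r")
    proof (intro equalityI subrelI)
      fix \<phi> \<psi> assume "(\<phi>, \<psi>) \<in> ?l"
      then have a: "J (\<phi>, \<psi>) \<in> Pi\<^sub>E V A" "(\<phi>, \<psi>) \<in> space (?X \<Otimes>\<^sub>M ?X)" by auto
      have "\<phi> x \<in> A x" if "x \<in> P" for x
        using PiE_mem[OF a(1), of x] that PV by (auto simp: J_def)
      moreover have "\<psi> x \<in> A (\<theta> x)" if "x \<in> P" for x
      proof -
        have "x \<in> V" using that PV by auto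
        moreover have "\<theta> x \<in> V" using \<theta>(1) calculation by auto
        moreover have "\<theta> x \<notin> P" using \<theta>(3) calculation that by auto
        ultimately show ?thesis using PiE_mem[OF a(1), of "\<theta> x"] \<theta>(2)[of x] by (simp add: J_def)
      qed
      ultimately show "(\<phi>, \<psi>) \<in> ?r"
        using a(2) by (auto simp: space_pair_measure space_PiM PiE_iff)
    next
      fix \<phi> \<psi> assume "(\<phi>, \<psi>) \<in> ?r"
      then have a: "\<phi> \<in> Pi\<^sub>E P A" "\<psi> \<in> Pi\<^sub>E P (A \<circ> \<theta>)" by auto
      have "J (\<phi>, \<psi>) x \<in> A x" if x: "x \<in> V" for x
      proof (cases "x \<in> P")
        case False
        then have "\<theta> x \<in> P" using \<theta> x by auto
        from PiE_mem[OF a(2) this] show ?thesis using False x \<theta>(2) by (simp add: J_def)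
      qed (use a(1) x in \<open>auto simp: J_def\<close>)
      then have "J (\<phi>, \<psi>) \<in> Pi\<^sub>E V A"
        by (auto simp: J_def)
      moreover have "(\<phi>, \<psi>) \<in> space (?X \<Otimes>\<^sub>M ?X)"
        using a Asp PV \<theta>(1) by (fastforce simp: space_pair_measure space_PiM PiE_iff)
      ultimately show "(\<phi>, \<psi>) \<in> ?l" by auto
    qed
    have "emeasure (distr (?X \<Otimes>\<^sub>M ?X) (\<Pi>\<^sub>M x\<in>V. M) J) (Pi\<^sub>E V A)
        = emeasure (?X \<Otimes>\<^sub>M ?X) (Pi\<^sub>E P A \<times> Pi\<^sub>E P (A \<circ> \<theta>))"
      using A V by (subst emeasure_distr) (auto simp: pre intro: sets_PiM_I_finite)
    also have "\<dots> = emeasure ?X (Pi\<^sub>E P A) * emeasure ?X (Pi\<^sub>E P (A \<circ> \<theta>))"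
      using A PV \<theta>(1) finP by (intro X.emeasure_pair_measure_Times sets_PiM_I_finite) auto
    also have "\<dots> = (\<Prod>x\<in>P. emeasure M (A x)) * (\<Prod>x\<in>P. emeasure M (A (\<theta> x)))"
      using A PV \<theta>(1) finP by (subst (1 2) emeasure_PiM) auto
    also have "(\<Prod>x\<in>P. emeasure M (A (\<theta> x))) = (\<Prod>x\<in>V - P. emeasure M (A x))"
      using PV \<theta> by (intro prod.reindex_bij_witness[of _ \<theta> \<theta>]) (auto 4 3)
    also have "(\<Prod>x\<in>P. emeasure M (A x)) * (\<Prod>x\<in>V - P. emeasure M (A x)) = (\<Prod>x\<in>V. emeasure M (A x))"
      using prod.subset_diff[OF PV V, of "\<lambda>x. emeasure M (A x)"] by (simp add: mult.commute)
    finally show "emeasure (distr (?X \<Otimes>\<^sub>M ?X) (\<Pi>\<^sub>M x\<in>V. M) J) (Pi\<^sub>E V A) = (\<Prod>x\<in>V. emeasure M (A x))" .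
  qed (use V in auto)
qed

text \<open>
  In terms of the pair of half configurations, edges inside either half contribute to the weight
  of one member of the pair, and a crossing edge couples \<open>\<phi>\<close> and \<open>\<psi>\<close> at one and the same site. Written in
  coordinates, this coupling is a product of the one-dimensional Gaussians of
  \<open>gaussian_coupling_Cauchy_Schwarz\<close>, with the field on the crossing edges absorbed into \<open>v\<close>.
\<close>

lemma reflection_positivity:
  fixes M :: "'a::euclidean_space measure" and h :: "'v \<times> 'v \<Rightarrow> 'a"
  assumes M: "prob_space M" and Mm: "(\<lambda>v. v) \<in> borel_measurable M" and V: "finite V"
    and E: "E \<subseteq> V \<times> V" and k: "0 < k" and rfl: "bond_reflection V E P \<theta>"
  shows "(shifted_partition M V E k h)\<^sup>2 \<le>
    shifted_partition M V E k (symmetrised_field P \<theta> h) *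
    shifted_partition M V E k (symmetrised_field (V - P) \<theta> h)"
proof -
  let ?X = "\<Pi>\<^sub>M x\<in>P. M"
  have P: "P \<subseteq> V" and \<theta>: "\<And>x. x \<in> V \<Longrightarrow> \<theta> x \<in> V" "\<And>x. x \<in> V \<Longrightarrow> \<theta> (\<theta> x) = x"
    "\<And>x. x \<in> V \<Longrightarrow> \<theta> x \<in> P \<longleftrightarrow> x \<notin> P"
    and \<theta>E: "\<And>x y. (x, y) \<in> E \<Longrightarrow> (\<theta> x, \<theta> y) \<in> E"
    and cross: "\<And>x y. (x, y) \<in> E \<Longrightarrow> (x \<in> P \<longleftrightarrow> y \<notin> P) \<Longrightarrow> y = \<theta> x"
    using rfl by (auto simp: bond_reflection_def)
  have EV: "x \<in> V" "y \<in> V" if "(x, y) \<in> E" for x y using E that by auto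
  have finE: "finite E" using E V by (meson finite_SigmaI finite_subset)
  interpret X: prob_space ?X by (rule prob_space_PiM) (rule M)
  define J where "J = (\<lambda>(\<phi> :: 'v \<Rightarrow> 'a, \<psi> :: 'v \<Rightarrow> 'a). \<lambda>x\<in>V. if x \<in> P then \<phi> x else \<psi> (\<theta> x))"
  have J[measurable]: "J \<in> measurable (?X \<Otimes>\<^sub>M ?X) (\<Pi>\<^sub>M x\<in>V. M)"
    and distrJ: "distr (?X \<Otimes>\<^sub>M ?X) (\<Pi>\<^sub>M x\<in>V. M) J = (\<Pi>\<^sub>M x\<in>V. M)"
    unfolding J_def using distr_glue_halves[OF M V P \<theta>] by auto
  define A where "A = {e\<in>E. fst e \<in> P \<and> snd e \<in> P}"
  define B where "B = {e\<in>E. fst e \<notin> P \<and> snd e \<notin> P}"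
  define C where "C = {e\<in>E. fst e \<in> P \<longleftrightarrow> snd e \<notin> P}"
  have split: "E = A \<union> B \<union> C" "A \<inter> B = {}" "(A \<union> B) \<inter> C = {}" by (auto simp: A_def B_def C_def)
  have fin: "finite A" "finite B" "finite C" using finE by (auto simp: A_def B_def C_def)
  define a where "a = (\<lambda>(h :: 'v \<times> 'v \<Rightarrow> 'a) \<phi>. \<Sum>(x, y)\<in>A. (norm (\<phi> x - \<phi> y + h (x, y)))\<^sup>2)"
  define b where "b = (\<lambda>(h :: 'v \<times> 'v \<Rightarrow> 'a) \<psi>. \<Sum>(x, y)\<in>B. (norm (\<psi> (\<theta> x) - \<psi> (\<theta> y) + h (x, y)))\<^sup>2)"
  \<comment> \<open>the end in \<open>P\<close> of a crossing edge\<close>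
  define pt where "pt = (\<lambda>(x, y). if x \<in> P then x else (y :: 'v))"
  have ptP: "pt e \<in> P" if "e \<in> C" for e using that by (auto simp: C_def pt_def split_beta)
  define u where "u = (\<lambda>(e, d) (\<phi> :: 'v \<Rightarrow> 'a). \<phi> (pt e) \<bullet> d)"
  \<comment> \<open>the sign in \<open>v\<close> records which end of the crossing edge lies in \<open>P\<close>\<close>
  define v where "v = (\<lambda>(h :: 'v \<times> 'v \<Rightarrow> 'a) (e, d) \<phi>. (\<phi> (pt e) - (if fst e \<in> P then h e else - h e)) \<bullet> d)"
  let ?I = "C \<times> (Basis :: 'a set)"
  have [measurable]: "(\<lambda>\<phi>. \<phi> x) \<in> borel_measurable ?X" if "x \<in> P" for x
    using measurable_compose[OF measurable_component_singleton[OF that] Mm] .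
  have um[measurable]: "u i \<in> borel_measurable ?X" if "i \<in> ?I" for i
  proof -
    obtain e d where i: "i = (e, d)" by fastforce
    have [measurable]: "pt e \<in> P" using ptP that i by auto
    show ?thesis unfolding u_def i by simp measurable
  qed
  have vm[measurable]: "v h i \<in> borel_measurable ?X" if "i \<in> ?I" for h i
  proof -
    obtain e d where i: "i = (e, d)" by fastforce
    have [measurable]: "pt e \<in> P" using ptP that i by auto
    show ?thesis unfolding v_def i by simp measurable
  qed
  have am[measurable]: "a h \<in> borel_measurable ?X" for h
    using gradient_energy_measurable[OF Mm, of A P h]
    by (auto simp: a_def gradient_energy_def[abs_def] A_def subset_iff)
  have bm[measurable]: "b h \<in> borel_measurable ?X" for h
    unfolding b_def split_beta
  proof (rule borel_measurable_sum)
    fix e assume "e \<in> B"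
    then have [measurable]: "\<theta> (fst e) \<in> P" "\<theta> (snd e) \<in> P"
      using \<theta>(3) EV[of "fst e" "snd e"] by (auto simp: B_def)
    show "(\<lambda>\<phi>. (norm (\<phi> (\<theta> (fst e)) - \<phi> (\<theta> (snd e)) + h (fst e, snd e)))\<^sup>2) \<in> borel_measurable ?X"
      by measurable
  qed
  have energy: "gradient_energy E h (J (\<phi>, \<psi>)) = a h \<phi> + b h \<psi> + (\<Sum>i\<in>?I. (u i \<phi> - v h i \<psi>)\<^sup>2)" for h \<phi> \<psi>
  proof -
    let ?f = "\<lambda>(x, y). (norm (J (\<phi>, \<psi>) x - J (\<phi>, \<psi>) y + h (x, y)))\<^sup>2"
    have "gradient_energy E h (J (\<phi>, \<psi>)) = sum ?f A + sum ?f B + sum ?f C"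
      unfolding gradient_energy_def split(1)
      using fin split by (simp add: sum.union_disjoint)
    also have "sum ?f A = a h \<phi>"
      unfolding a_def using EV by (intro sum.cong) (auto simp: A_def J_def)
    also have "sum ?f B = b h \<psi>"
      unfolding b_def using EV by (intro sum.cong) (auto simp: B_def J_def)
    also have "sum ?f C = (\<Sum>e\<in>C. \<Sum>d\<in>Basis. (u (e, d) \<phi> - v h (e, d) \<psi>)\<^sup>2)"
    proof (rule sum.cong[OF refl])
      fix e assume e: "e \<in> C"
      obtain x y where xy: "e = (x, y)" by fastforce
      have xyE: "(x, y) \<in> E" and c: "x \<in> P \<longleftrightarrow> y \<notin> P" using e xy by (auto simp: C_def)
      have y: "y = \<theta> x" using cross[OF xyE c] .
      have tx: "\<theta> y = x" using y \<theta>(2) EV[OF xyE] by auto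
      let ?w = "\<phi> (pt e) - (\<psi> (pt e) - (if fst e \<in> P then h e else - h e))"
      have "?f e = (norm ?w)\<^sup>2"
      proof (cases "x \<in> P")
        case True
        then show ?thesis using c EV[OF xyE] tx by (simp add: xy J_def pt_def algebra_simps)
      next
        case False
        then have "?f e = (norm (\<psi> y - \<phi> y + h e))\<^sup>2"
          using c EV[OF xyE] y by (simp add: xy J_def pt_def)
        also have "\<dots> = (norm (- (\<psi> y - \<phi> y + h e)))\<^sup>2" by (simp only: norm_minus_cancel)
        finally show ?thesis using False by (simp add: xy pt_def algebra_simps)
      qed
      also have "\<dots> = (\<Sum>d\<in>Basis. (?w \<bullet> d)\<^sup>2)"
        by (rule power2_norm_eq_sum_inner)
      also have "\<dots> = (\<Sum>d\<in>Basis. (u (e, d) \<phi> - v h (e, d) \<psi>)\<^sup>2)"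
        by (simp add: u_def v_def inner_diff_left)
      finally show "?f e = (\<Sum>d\<in>Basis. (u (e, d) \<phi> - v h (e, d) \<psi>)\<^sup>2)" .
    qed
    also have "\<dots> = (\<Sum>i\<in>?I. (u i \<phi> - v h i \<psi>)\<^sup>2)"
      by (simp add: sum.cartesian_product)
    finally show ?thesis .
  qed
  let ?K = "\<lambda>a b u v. \<integral>\<^sup>+\<phi>. \<integral>\<^sup>+\<psi>. ennreal (exp (- k * a \<phi>)) * ennreal (exp (- k * b \<psi>)) *
      (\<Prod>i\<in>?I. ennreal (exp (- k * (u i \<phi> - v i \<psi>)\<^sup>2))) \<partial>?X \<partial>?X"
  have W: "shifted_partition M V E k h = ?K (a h) (b h) u (v h)" for h
  proof -
    have [measurable]: "gradient_energy E h \<in> borel_measurable (\<Pi>\<^sub>M x\<in>V. M)"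
      by (rule gradient_energy_measurable[OF Mm E])
    have "shifted_partition M V E k h = (\<integral>\<^sup>+\<phi>. ennreal (exp (- k * gradient_energy E h \<phi>))
        \<partial>distr (?X \<Otimes>\<^sub>M ?X) (\<Pi>\<^sub>M x\<in>V. M) J)"
      unfolding shifted_partition_def distrJ ..
    also have "\<dots> = (\<integral>\<^sup>+p. ennreal (exp (- k * gradient_energy E h (J p))) \<partial>(?X \<Otimes>\<^sub>M ?X))"
      by (rule nn_integral_distr) measurable
    also have "\<dots> = (\<integral>\<^sup>+\<phi>. \<integral>\<^sup>+\<psi>. ennreal (exp (- k * gradient_energy E h (J (\<phi>, \<psi>)))) \<partial>?X \<partial>?X)"
      by (rule X.nn_integral_fst[symmetric]) measurable
    also have "\<dots> = ?K (a h) (b h) u (v h)"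
    proof (intro nn_integral_cong)
      fix \<phi> \<psi>
      have "exp (- k * gradient_energy E h (J (\<phi>, \<psi>))) =
         exp (- k * a h \<phi>) * exp (- k * b h \<psi>) * (\<Prod>i\<in>?I. exp (- k * (u i \<phi> - v h i \<psi>)\<^sup>2))"
        unfolding energy using fin(3)
        by (simp only: distrib_left sum_distrib_left exp_add exp_sum finite_cartesian_product finite_Basis)
      then show "ennreal (exp (- k * gradient_energy E h (J (\<phi>, \<psi>)))) =
         ennreal (exp (- k * a h \<phi>)) * ennreal (exp (- k * b h \<psi>)) *
         (\<Prod>i\<in>?I. ennreal (exp (- k * (u i \<phi> - v h i \<psi>)\<^sup>2)))"
        by (simp add: ennreal_mult prod_ennreal prod_nonneg)
    qed
    finally show ?thesis .
  qed
  let ?hP = "symmetrised_field P \<theta> h" and ?hQ = "symmetrised_field (V - P) \<theta> h"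
  have aP: "a ?hP = a h"
    unfolding a_def by (intro ext sum.cong) (auto simp: A_def symmetrised_field_def)
  have bP: "b ?hP = a h"
    unfolding a_def b_def
  proof (intro ext, rule sum.reindex_bij_witness[of _ "\<lambda>(x, y). (\<theta> x, \<theta> y)" "\<lambda>(x, y). (\<theta> x, \<theta> y)"])
  qed (use \<theta> \<theta>E EV in \<open>auto simp: A_def B_def symmetrised_field_def\<close>)
  have vP: "v ?hP i = u i" if "i \<in> ?I" for i
    using that by (auto simp: v_def u_def C_def symmetrised_field_def)
  have bQ: "b ?hQ = b h"
    unfolding b_def using EV by (intro ext sum.cong) (auto simp: B_def symmetrised_field_def)
  have aQ: "a ?hQ = b h"
    unfolding a_def b_def
  proof (intro ext, rule sum.reindex_bij_witness[of _ "\<lambda>(x, y). (\<theta> x, \<theta> y)" "\<lambda>(x, y). (\<theta> x, \<theta> y)"])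
  qed (use \<theta> \<theta>E EV in \<open>auto simp: A_def B_def symmetrised_field_def\<close>)
  have vQ: "v ?hQ i = u i" if "i \<in> ?I" for i
    using that EV by (auto simp: v_def u_def C_def symmetrised_field_def)
  have vv: "v h i \<phi> - v h i \<psi> = u i \<phi> - u i \<psi>" for i \<phi> \<psi>
    by (cases i) (auto simp: v_def u_def inner_diff_left)
  have WP: "shifted_partition M V E k ?hP = ?K (a h) (a h) u u"
    unfolding W aP bP by (intro nn_integral_cong arg_cong2[where f="(*)"] prod.cong refl) (simp only: vP)
  have WQ: "shifted_partition M V E k ?hQ = ?K (b h) (b h) (v h) (v h)"
    unfolding W aQ bQ vv by (intro nn_integral_cong arg_cong2[where f="(*)"] prod.cong refl) (simp only: vQ)
  show ?thesis
    unfolding W[of h] WP WQ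
    by (rule gaussian_coupling_Cauchy_Schwarz)
      (use k fin um vm in \<open>auto intro: X.sigma_finite_measure_axioms\<close>)
qed

section \<open>Gaussian domination and the infrared bound\<close>

lemma shifted_partition_cong:
  assumes "\<And>e. e \<in> E \<Longrightarrow> h e = h' e"
  shows "shifted_partition M V E k h = shifted_partition M V E k h'"
proof -
  have "gradient_energy E h = gradient_energy E h'"
    unfolding gradient_energy_def using assms by (intro ext sum.cong) auto
  then show ?thesis by (simp add: shifted_partition_def)
qed

lemma shifted_partition_finite:
  assumes M: "prob_space M" and k: "0 < k"
  shows "shifted_partition M V E k h \<noteq> \<infinity>"
proof -
  interpret prob_space "\<Pi>\<^sub>M x\<in>V. M" by (rule prob_space_PiM) (rule M)
  have "shifted_partition M V E k h \<le> (\<integral>\<^sup>+\<phi>. 1 \<partial>(\<Pi>\<^sub>M x\<in>V. M))"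
    unfolding shifted_partition_def
    using k by (intro nn_integral_mono) (auto simp: gradient_energy_def split_beta intro!: mult_nonneg_nonneg sum_nonneg)
  also have "\<dots> = 1" by (simp add: emeasure_space_1)
  finally show ?thesis by (auto simp: top_unique)
qed

text \<open>
  Nonzero values survive only inside \<open>P\<close> and in its mirror image. Summed over the two halves, this
  is at most twice the number of nonzero non-crossing bonds of \<open>g\<close>, so one of the two symmetrised fields
  has fewer nonzero bonds than \<open>g\<close> whenever \<open>g\<close> is nonzero on a crossing edge.
\<close>

lemma card_support_symmetrised_field:
  assumes "finite E"
    and mirror: "\<And>x y. (x, y) \<in> E \<Longrightarrow> (\<theta> x, \<theta> y) \<in> E \<and> \<theta> (\<theta> x) = x \<and> \<theta> (\<theta> y) = y
       \<and> (\<theta> x \<in> P \<longleftrightarrow> x \<notin> P) \<and> (\<theta> y \<in> P \<longleftrightarrow> y \<notin> P)"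
  shows "card {e \<in> E. symmetrised_field P \<theta> g e \<noteq> 0}
    \<le> 2 * card {e \<in> E. fst e \<in> P \<and> snd e \<in> P \<and> g e \<noteq> 0}"
proof -
  let ?S = "{e \<in> E. fst e \<in> P \<and> snd e \<in> P \<and> g e \<noteq> 0}"
  let ?\<tau> = "\<lambda>(x, y). (\<theta> x, \<theta> y)"
  have "{e \<in> E. symmetrised_field P \<theta> g e \<noteq> 0} \<subseteq> ?S \<union> ?\<tau> ` ?S"
  proof (intro subsetI)
    fix e assume e: "e \<in> {e \<in> E. symmetrised_field P \<theta> g e \<noteq> 0}"
    obtain x y where xy: "e = (x, y)" by fastforce
    show "e \<in> ?S \<union> ?\<tau> ` ?S"
    proof (cases "x \<in> P \<and> y \<in> P")
      case True
      then show ?thesis using e by (auto simp: xy symmetrised_field_def)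
    next
      case False
      then have "(\<theta> x, \<theta> y) \<in> ?S" "?\<tau> (\<theta> x, \<theta> y) = e"
        using e mirror[of x y] by (auto simp: xy symmetrised_field_def split: if_splits)
      then show ?thesis by (metis (no_types, lifting) UnI2 imageI)
    qed
  qed
  moreover have fin: "finite ?S" using assms by auto
  ultimately have "card {e \<in> E. symmetrised_field P \<theta> g e \<noteq> 0} \<le> card (?S \<union> ?\<tau> ` ?S)"
    by (intro card_mono) auto
  also have "\<dots> \<le> card ?S + card (?\<tau> ` ?S)" by (rule card_Un_le)
  also have "\<dots> \<le> 2 * card ?S" using card_image_le[OF fin, of ?\<tau>] by simp
  finally show ?thesis .
qed

text \<open>
  Symmetrisation creates no values outside \<open>h ` E \<union> {0}\<close>, so the maximum can be sought in a finite
  set of fields. If \<open>g\<close> is a maximiser, reflection positivity makes both symmetrised fields maximisers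
  as well; when \<open>g\<close> has the smallest support among all maximisers, the count above shows that no edge
  with \<open>g e \<noteq> 0\<close> can be crossed by a mirror.
\<close>

theorem gaussian_domination:
  fixes M :: "'a::euclidean_space measure" and h :: "'v \<times> 'v \<Rightarrow> 'a"
  assumes M: "prob_space M" and Mm: "(\<lambda>v. v) \<in> borel_measurable M" and V: "finite V"
    and E: "E \<subseteq> V \<times> V" and k: "0 < k"
    and refl: "\<And>x y. (x, y) \<in> E \<Longrightarrow> \<exists>P \<theta>. bond_reflection V E P \<theta> \<and> (x \<in> P \<longleftrightarrow> y \<notin> P)"
  shows "shifted_partition M V E k h \<le> shifted_partition M V E k (\<lambda>_. 0)"
proof -
  let ?W = "shifted_partition M V E k"
  have finE: "finite E" using E V by (meson finite_SigmaI finite_subset)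
  define F where "F = (\<Pi>\<^sub>E e\<in>E. insert 0 (h ` E))"
  have F: "finite F" "restrict h E \<in> F"
    using finE by (auto simp: F_def intro!: finite_PiE)
  define G where "G = {g \<in> F. \<forall>g'\<in>F. ?W g' \<le> ?W g}"
  have "\<exists>g. g \<in> G"
  proof -
    have "Max (?W ` F) \<in> ?W ` F" using F by (intro Max_in) auto
    then obtain g where "g \<in> F" "?W g = Max (?W ` F)" by auto
    then show ?thesis using F(1) by (auto simp: G_def)
  qed
  then obtain g where g: "g \<in> G"
    and least: "\<And>g'. g' \<in> G \<Longrightarrow> card {e \<in> E. g e \<noteq> 0} \<le> card {e \<in> E. g' e \<noteq> 0}"
    using ex_has_least_nat[of "\<lambda>g. g \<in> G" _ "\<lambda>g. card {e \<in> E. g e \<noteq> 0}"] by blast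
  have gF: "g \<in> F" and gmax: "\<And>g'. g' \<in> F \<Longrightarrow> ?W g' \<le> ?W g" using g by (auto simp: G_def)
  have "g e = 0" if eE: "e \<in> E" for e
  proof (rule ccontr)
    assume ge: "g e \<noteq> 0"
    obtain x y where xy: "e = (x, y)" by fastforce
    obtain P \<theta> where r: "bond_reflection V E P \<theta>" and c: "x \<in> P \<longleftrightarrow> y \<notin> P"
      using refl eE xy by blast
    have \<theta>: "\<theta> x \<in> V" "\<theta> (\<theta> x) = x" "\<theta> x \<in> P \<longleftrightarrow> x \<notin> P" if "x \<in> V" for x
      using that r by (auto simp: bond_reflection_def)
    have \<theta>E: "(\<theta> x, \<theta> y) \<in> E" if "(x, y) \<in> E" for x y
      using that r by (auto simp: bond_reflection_def)
    have EV: "x \<in> V" "y \<in> V" if "(x, y) \<in> E" for x y using E that by auto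
    define p where "p = restrict (symmetrised_field P \<theta> g) E"
    define q where "q = restrict (symmetrised_field (V - P) \<theta> g) E"
    have gv: "g e = 0 \<or> g e \<in> h ` E" if "e \<in> E" for e
      using PiE_mem[OF gF[unfolded F_def] that] by simp
    have "symmetrised_field S \<theta> g e \<in> insert 0 (h ` E)" if "e \<in> E" for S e
      using that gv[of e] gv[of "(\<theta> (fst e), \<theta> (snd e))"] \<theta>E[of "fst e" "snd e"]
      by (auto simp: symmetrised_field_def split_beta)
    then have pF: "p \<in> F" and qF: "q \<in> F"
      by (simp_all only: p_def q_def F_def restrict_PiE_iff) blast+
    have "(?W g)\<^sup>2 \<le> ?W p * ?W q"
      using reflection_positivity[OF M Mm V E k r, of g]
        shifted_partition_cong[of E p "symmetrised_field P \<theta> g" M V k]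
        shifted_partition_cong[of E q "symmetrised_field (V - P) \<theta> g" M V k]
      by (simp add: p_def q_def)
    moreover have "?W g \<noteq> top" using shifted_partition_finite[OF M k] by auto
    moreover have "?W p \<le> ?W g" "?W q \<le> ?W g" using gmax pF qF by auto
    ultimately have "?W g \<le> ?W p" "?W g \<le> ?W q"
    proof -
      assume a: "(?W g)\<^sup>2 \<le> ?W p * ?W q" "?W g \<noteq> top" "?W p \<le> ?W g" "?W q \<le> ?W g"
      have "?W g * ?W g \<le> ?W g * ?W p"
        using a(1) mult_left_mono[OF a(4), of "?W p"] by (simp add: power2_eq_square mult.commute)
      then show "?W g \<le> ?W p"
        using a(2) by (cases "?W g = 0") (auto simp: ennreal_mult_le_mult_iff)
      have "?W g * ?W g \<le> ?W g * ?W q"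
        using a(1) mult_right_mono[OF a(3), of "?W q"] by (simp add: power2_eq_square)
      then show "?W g \<le> ?W q"
        using a(2) by (cases "?W g = 0") (auto simp: ennreal_mult_le_mult_iff)
    qed
    then have "p \<in> G" "q \<in> G"
      using pF qF gmax unfolding G_def by (auto intro: order_trans)
    then have "card {e \<in> E. g e \<noteq> 0} \<le> card {e \<in> E. p e \<noteq> 0}"
      "card {e \<in> E. g e \<noteq> 0} \<le> card {e \<in> E. q e \<noteq> 0}" using least by auto
    moreover have "card {e \<in> E. p e \<noteq> 0} \<le> 2 * card {e \<in> E. fst e \<in> P \<and> snd e \<in> P \<and> g e \<noteq> 0}"
    proof -
      have "{e \<in> E. p e \<noteq> 0} = {e \<in> E. symmetrised_field P \<theta> g e \<noteq> 0}" by (auto simp: p_def)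
      then show ?thesis
        using card_support_symmetrised_field[OF finE, of \<theta> P g] \<theta> \<theta>E EV by simp
    qed
    moreover have "card {e \<in> E. q e \<noteq> 0} \<le> 2 * card {e \<in> E. fst e \<in> V - P \<and> snd e \<in> V - P \<and> g e \<noteq> 0}"
    proof -
      have "{e \<in> E. q e \<noteq> 0} = {e \<in> E. symmetrised_field (V - P) \<theta> g e \<noteq> 0}" by (auto simp: q_def)
      then show ?thesis
        using card_support_symmetrised_field[OF finE, of \<theta> "V - P" g] \<theta> \<theta>E EV by simp
    qed
    moreover have "card {e \<in> E. fst e \<in> P \<and> snd e \<in> P \<and> g e \<noteq> 0}
      + card {e \<in> E. fst e \<in> V - P \<and> snd e \<in> V - P \<and> g e \<noteq> 0} < card {e \<in> E. g e \<noteq> 0}"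
    proof -
      let ?A = "{e \<in> E. fst e \<in> P \<and> snd e \<in> P \<and> g e \<noteq> 0}"
      let ?B = "{e \<in> E. fst e \<in> V - P \<and> snd e \<in> V - P \<and> g e \<noteq> 0}"
      have "card ?A + card ?B = card (?A \<union> ?B)"
        using finE by (intro card_Un_disjoint[symmetric]) auto
      also have "\<dots> < card {e \<in> E. g e \<noteq> 0}"
      proof (rule psubset_card_mono)
        have "e \<in> {e \<in> E. g e \<noteq> 0}" "e \<notin> ?A \<union> ?B" using eE ge c xy by auto
        then show "?A \<union> ?B \<subset> {e \<in> E. g e \<noteq> 0}" by blast
      qed (use finE in auto)
      finally show ?thesis .
    qed
    ultimately show False by linarith
  qed
  then have "?W g = ?W (\<lambda>_. 0)" by (rule shifted_partition_cong)
  moreover have "?W h = ?W (restrict h E)" by (rule shifted_partition_cong) simp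
  ultimately show ?thesis using gmax[OF F(2)] by simp
qed

lemma cosh_ge_one_plus_half_square: "1 + s\<^sup>2 / 2 \<le> cosh (s :: real)"
proof -
  have "(\<Sum>n<3. if even n then s ^ n /\<^sub>R fact n else 0) \<le> (\<Sum>n. if even n then s ^ n /\<^sub>R fact n else 0)"
    using cosh_converges[of s] by (intro sum_le_suminf) (auto simp: sums_iff zero_le_even_power)
  then show ?thesis using cosh_converges[of s] by (simp add: sums_iff eval_nat_numeral)
qed

text \<open>
  Gaussian domination for \<open>t h\<close> and \<open>- t h\<close> bounds the mean of \<open>cosh (2 k t A)\<close>, where \<open>A\<close> is the linear
  observable, and \<open>cosh s \<ge> 1 + s\<^sup>2 / 2\<close> extracts the second moment. A single well-chosen \<open>t\<close>
  replaces the limit \<open>t \<rightarrow> 0\<close> at the cost of a constant factor.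
\<close>

theorem infrared_bound:
  fixes M :: "'a::euclidean_space measure" and h :: "'v \<times> 'v \<Rightarrow> 'a"
  assumes M: "prob_space M" and Mm: "(\<lambda>v. v) \<in> borel_measurable M" and V: "finite V"
    and E: "E \<subseteq> V \<times> V" and k: "0 < k"
    and refl: "\<And>x y. (x, y) \<in> E \<Longrightarrow> \<exists>P \<theta>. bond_reflection V E P \<theta> \<and> (x \<in> P \<longleftrightarrow> y \<notin> P)"
  shows "(\<integral>\<^sup>+\<phi>. ennreal ((\<Sum>(x, y)\<in>E. (\<phi> x - \<phi> y) \<bullet> h (x, y))\<^sup>2 *
          exp (- k * gradient_energy E (\<lambda>_. 0) \<phi>)) \<partial>(\<Pi>\<^sub>M x\<in>V. M))
    \<le> ennreal ((\<Sum>e\<in>E. (norm (h e))\<^sup>2) / k) *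
       (\<integral>\<^sup>+\<phi>. ennreal (exp (- k * gradient_energy E (\<lambda>_. 0) \<phi>)) \<partial>(\<Pi>\<^sub>M x\<in>V. M))"
    (is "?I \<le> ennreal (?Q / k) * ?Z")
proof -
  let ?\<mu> = "\<Pi>\<^sub>M x\<in>V. M"
  have finE: "finite E" using E V by (meson finite_SigmaI finite_subset)
  define Q where "Q = (\<Sum>e\<in>E. (norm (h e))\<^sup>2)"
  define A where "A = (\<lambda>\<phi>. \<Sum>(x, y)\<in>E. (\<phi> x - \<phi> y) \<bullet> h (x, y))"
  have A_eq: "(\<Sum>(x, y)\<in>E. (\<phi> x - \<phi> y) \<bullet> h (x, y)) = A \<phi>" for \<phi> by (simp add: A_def)
  let ?D = "gradient_energy E (\<lambda>_. 0)"
  have Dm[measurable]: "gradient_energy E h \<in> borel_measurable ?\<mu>" for h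
    by (rule gradient_energy_measurable[OF Mm E])
  have en: "gradient_energy E (\<lambda>e. t *\<^sub>R h e) \<phi> = ?D \<phi> + 2 * t * A \<phi> + t\<^sup>2 * Q" for t \<phi>
  proof -
    have "gradient_energy E (\<lambda>e. t *\<^sub>R h e) \<phi> = (\<Sum>(x, y)\<in>E. (norm (\<phi> x - \<phi> y + 0))\<^sup>2
        + 2 * t * ((\<phi> x - \<phi> y) \<bullet> h (x, y)) + t\<^sup>2 * (norm (h (x, y)))\<^sup>2)"
      unfolding gradient_energy_def
      by (intro sum.cong refl) (auto simp: power2_norm_eq_inner inner_add inner_commute
          power2_eq_square[of t] algebra_simps)
    then show ?thesis
      by (simp add: gradient_energy_def A_def Q_def sum.distrib sum_distrib_left split_beta)
  qed
  have "?I \<le> ennreal (Q / k) * ?Z"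
  proof (cases "Q = 0")
    case True
    then have "\<forall>e\<in>E. h e = 0" using finE unfolding Q_def by (subst (asm) sum_nonneg_eq_0_iff) auto
    then have "A \<phi> = 0" for \<phi> unfolding A_def by (intro sum.neutral) auto
    then show ?thesis unfolding A_eq by simp
  next
    case False
    then have Q: "0 < Q"
      using sum_nonneg[of E "\<lambda>e. (norm (h e))\<^sup>2"] by (simp add: Q_def)
    \<comment> \<open>makes the quadratic cost \<open>k t\<^sup>2 Q\<close> equal to \<open>1\<close>\<close>
    define t where "t = 1 / sqrt (k * Q)"
    have t: "k * (t\<^sup>2 * Q) = 1" using k Q by (simp add: t_def power_divide)
    let ?p = "\<lambda>\<phi>. exp (- k * gradient_energy E (\<lambda>e. t *\<^sub>R h e) \<phi>)"
    let ?m = "\<lambda>\<phi>. exp (- k * gradient_energy E (\<lambda>e. (- t) *\<^sub>R h e) \<phi>)"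
    have pw: "Q / (2 * k) * exp (- k * ?D \<phi>) + (A \<phi>)\<^sup>2 * exp (- k * ?D \<phi>)
        \<le> 3 * Q / (4 * k) * ?p \<phi> + 3 * Q / (4 * k) * ?m \<phi>" for \<phi>
    proof -
      define s where "s = 2 * k * t * A \<phi>"
      have "?p \<phi> = exp (- k * ?D \<phi>) * exp (- s) * exp (- 1)"
        unfolding en mult_exp_exp using t by (simp add: s_def algebra_simps)
      moreover have "?m \<phi> = exp (- k * ?D \<phi>) * exp s * exp (- 1)"
        unfolding en mult_exp_exp using t by (simp add: s_def algebra_simps)
      moreover have "2 + s\<^sup>2 \<le> exp s + exp (- s)"
        using cosh_ge_one_plus_half_square[of s] by (simp add: cosh_def)
      moreover have "s\<^sup>2 = 4 * k / Q * (A \<phi>)\<^sup>2"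
      proof -
        have "s\<^sup>2 * Q = 4 * k * (A \<phi>)\<^sup>2 * (k * (t\<^sup>2 * Q))"
          by (simp add: s_def power2_eq_square)
        then have "s\<^sup>2 * Q = 4 * k * (A \<phi>)\<^sup>2" unfolding t by simp
        then show ?thesis using Q by (simp add: eq_divide_eq)
      qed
      moreover have "1 \<le> 3 * exp (- 1 :: real)"
        using exp_le by (simp add: exp_minus field_simps)
      ultimately have p: "?p \<phi> + ?m \<phi> = exp (- k * ?D \<phi>) * exp (- 1) * (exp s + exp (- s))"
        and le: "2 + 4 * k / Q * (A \<phi>)\<^sup>2 \<le> exp s + exp (- s)" and e3: "1 \<le> 3 * exp (- 1 :: real)"
        by (simp_all add: algebra_simps)
      have "Q / (2 * k) * exp (- k * ?D \<phi>) + (A \<phi>)\<^sup>2 * exp (- k * ?D \<phi>)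
          = Q / (4 * k) * exp (- k * ?D \<phi>) * (2 + 4 * k / Q * (A \<phi>)\<^sup>2) * 1"
        using k Q by (simp add: field_simps)
      also have "\<dots> \<le> Q / (4 * k) * exp (- k * ?D \<phi>) * (exp s + exp (- s)) * (3 * exp (- 1))"
        using k Q le e3 by (intro mult_mono mult_left_mono) auto
      also have "\<dots> = 3 * Q / (4 * k) * (?p \<phi> + ?m \<phi>)"
        unfolding p by simp
      finally show ?thesis by (simp only: distrib_left)
    qed
    have W: "shifted_partition M V E k g \<le> ?Z" for g
      using gaussian_domination[OF assms, of g] by (simp add: shifted_partition_def)
    have Zfin: "?Z \<noteq> \<infinity>" using shifted_partition_finite[OF M k, of V E "\<lambda>_. 0"] by (simp add: shifted_partition_def)
    have [measurable]: "A \<in> borel_measurable ?\<mu>"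
    proof -
      have "A = (\<lambda>\<phi>. (gradient_energy E h \<phi> - ?D \<phi> - Q) / 2)"
        using en[of 1] by (intro ext) simp
      then show ?thesis by simp measurable
    qed
    define c c' where c_def: "c = Q / (2 * k)" and c'_def: "c' = 3 * Q / (4 * k)"
    have c: "0 \<le> c" "0 \<le> c'" "c' + c' = c + Q / k" using k Q by (auto simp: c_def c'_def field_simps)
    note pw' = pw[folded c_def c'_def]
    have "ennreal (c) * ?Z + ?I
      = (\<integral>\<^sup>+\<phi>. ennreal (c * exp (- k * ?D \<phi>) + (A \<phi>)\<^sup>2 * exp (- k * ?D \<phi>)) \<partial>?\<mu>)"
      using c(1,2) unfolding A_eq by (simp add: ennreal_plus ennreal_mult nn_integral_add nn_integral_cmult)
    also have "\<dots> \<le> (\<integral>\<^sup>+\<phi>. ennreal (c' * ?p \<phi> + c' * ?m \<phi>) \<partial>?\<mu>)"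
      by (intro nn_integral_mono ennreal_leI pw')
    also have "\<dots> = ennreal (c') * shifted_partition M V E k (\<lambda>e. t *\<^sub>R h e)
        + ennreal (c') * shifted_partition M V E k (\<lambda>e. (- t) *\<^sub>R h e)"
      using c(1,2) unfolding shifted_partition_def
      by (simp add: ennreal_plus ennreal_mult nn_integral_add nn_integral_cmult)
    also have "\<dots> \<le> ennreal (c') * ?Z + ennreal (c') * ?Z"
      by (intro add_mono mult_left_mono W) auto
    also have "\<dots> = ennreal (c) * ?Z + ennreal (Q / k) * ?Z"
      using c k Q by (simp only: distrib_right[symmetric] ennreal_plus[symmetric] divide_nonneg_pos less_imp_le)
    finally show ?thesis
      using Zfin by (subst (asm) ennreal_add_left_cancel_le) (auto simp: ennreal_mult_eq_top_iff)
  qed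
  then show ?thesis by (simp only: Q_def)
qed

section \<open>Reflections of the torus\<close>

definition torus_step :: "nat \<Rightarrow> nat \<Rightarrow> site \<Rightarrow> site" where
  "torus_step L i x = x(i := (x i + 1) mod int L)"

definition torus_bonds :: "nat \<Rightarrow> nat \<Rightarrow> (site \<times> site) set" where
  "torus_bonds d L = {(x, y). {x, y} \<in> torus_edges d L}"

lemma finite_torus: "finite (torus d L)"
  unfolding torus_def by (intro finite_PiE) auto

lemma torus_step_in_torus: "0 < L \<Longrightarrow> x \<in> torus d L \<Longrightarrow> i < d \<Longrightarrow> torus_step L i x \<in> torus d L"
  by (auto simp: torus_def torus_step_def PiE_iff extensional_def)

lemma torus_step_neq:
  assumes "2 \<le> L" "x \<in> torus d L" "i < d"
  shows "torus_step L i x \<noteq> x"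
proof
  assume "torus_step L i x = x"
  then have "(x i + 1) mod int L = x i" by (metis torus_step_def fun_upd_same)
  moreover have "0 \<le> x i" "x i < int L" using assms by (auto simp: torus_def PiE_iff)
  ultimately show False
    using assms(1) by (cases "x i + 1 = int L") auto
qed

lemma torus_bonds_cases:
  assumes "(x, y) \<in> torus_bonds d L"
  obtains z i where "z \<in> torus d L" "i < d" "(x, y) = (z, torus_step L i z) \<or> (x, y) = (torus_step L i z, z)"
  using assms by (auto simp: torus_bonds_def torus_edges_def torus_step_def doubleton_eq_iff)

lemma torus_bondsI:
  assumes "x \<in> torus d L" "i < d"
  shows "(x, torus_step L i x) \<in> torus_bonds d L" "(torus_step L i x, x) \<in> torus_bonds d L"
  using assms by (auto simp: torus_bonds_def torus_edges_def torus_step_def insert_commute)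

lemma torus_bonds_subset: "0 < L \<Longrightarrow> torus_bonds d L \<subseteq> torus d L \<times> torus d L"
  by (auto elim!: torus_bonds_cases simp: torus_step_in_torus)

lemma mod_reflect:
  fixes a l :: int
  assumes "0 < l"
  shows "(- a - 1) mod l = l - 1 - a mod l"
proof -
  have "(- a - 1) mod l = (l - 1 - a mod l) mod l"
    by (metis diff_diff_add diff_right_commute mod_diff_right_eq mod_self minus_mod_self1 uminus_add_conv_diff
        add.commute diff_add_cancel mod_add_self2)
  also have "\<dots> = l - 1 - a mod l"
    using assms pos_mod_bound[of l a] pos_mod_sign[of l a] by (intro mod_pos_pos_trivial) linarith+
  finally show ?thesis .
qed

text \<open>
  The mirror stands between \<open>c\<close> and \<open>c + 1\<close> in direction \<open>i\<close>. Measured by \<open>r = (z i - c - 1) mod L\<close>, it acts as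
  \<open>r \<mapsto> L - 1 - r\<close>. Evenness of \<open>L\<close> makes it cut the circle a second time between two sites, at
  \<open>r = L / 2 - 1\<close>, instead of passing through a site.
\<close>

lemma torus_bond_reflection:
  assumes L: "even L" "0 < L" and i: "i < d"
  shows "bond_reflection (torus d L) (torus_bonds d L)
    {z \<in> torus d L. (z i - c - 1) mod int L < int (L div 2)} (\<lambda>z. z(i := (2 * c + 1 - z i) mod int L))"
    (is "bond_reflection ?V ?E ?P ?\<theta>")
proof -
  define l where "l = int L"
  define m where "m = int (L div 2)"
  have lm: "l = 2 * m" "0 < m" using L by (auto simp: l_def m_def elim!: evenE)
  let ?r = "\<lambda>z :: site. (z i - c - 1) mod l"
  have range: "0 \<le> z i" "z i < l" if "z \<in> ?V" for z
    using that i by (auto simp: torus_def l_def PiE_iff)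
  have \<theta>V: "?\<theta> z \<in> ?V" if "z \<in> ?V" for z
    using that i L by (auto simp: torus_def PiE_iff extensional_def)
  have inv: "?\<theta> (?\<theta> z) = z" if "z \<in> ?V" for z
    using range[OF that] by (auto simp: mod_diff_right_eq simp flip: l_def)
  have flip: "?r (?\<theta> z) = l - 1 - ?r z" for z
  proof -
    have "?r (?\<theta> z) = (- (z i - c - 1) - 1) mod l"
      by (simp add: mod_diff_left_eq algebra_simps flip: l_def)
    also have "\<dots> = l - 1 - ?r z" using lm by (intro mod_reflect) simp
    finally show ?thesis .
  qed
  have flipP: "?\<theta> z \<in> ?P \<longleftrightarrow> z \<notin> ?P" if "z \<in> ?V" for z
    using that \<theta>V[OF that] flip[of z] lm by (auto simp flip: l_def m_def)
  have commute: "?\<theta> (torus_step L j z) = torus_step L j (?\<theta> z)" if "j \<noteq> i" for j z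
    using that by (auto simp: torus_step_def fun_upd_twist)
  have reverse: "torus_step L i (?\<theta> (torus_step L i z)) = ?\<theta> z" for z
    by (auto simp: torus_step_def mod_simps algebra_simps)
  have E\<theta>: "(?\<theta> z, ?\<theta> (torus_step L j z)) \<in> ?E \<and> (?\<theta> (torus_step L j z), ?\<theta> z) \<in> ?E"
    if z: "z \<in> ?V" and j: "j < d" for z j
  proof (cases "j = i")
    case True
    have "?\<theta> (torus_step L i z) \<in> ?V" using z i L \<theta>V torus_step_in_torus by blast
    from torus_bondsI[OF this i] show ?thesis unfolding True reverse by simp
  next
    case False
    show ?thesis using torus_bondsI[OF \<theta>V[OF z] j] unfolding commute[OF False] by simp
  qed
  have cross: "torus_step L j z = ?\<theta> z \<and> z = ?\<theta> (torus_step L j z)"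
    if z: "z \<in> ?V" and j: "j < d" and c: "z \<in> ?P \<longleftrightarrow> torus_step L j z \<notin> ?P" for z j
  proof -
    have zs: "torus_step L j z \<in> ?V" using z j L torus_step_in_torus by blast
    have "j = i"
    proof (rule ccontr)
      assume "j \<noteq> i"
      then have "torus_step L j z i = z i" by (simp add: torus_step_def)
      then show False using c z zs by auto
    qed
    have step: "?r (torus_step L i z) = (?r z + 1) mod l"
      by (simp add: torus_step_def mod_simps algebra_simps flip: l_def)
    have r: "0 \<le> ?r z" "?r z < l" using lm by auto
    have c': "?r z < m \<longleftrightarrow> \<not> (?r z + 1) mod l < m"
      using c z zs step unfolding \<open>j = i\<close> by (auto simp flip: l_def m_def)
    \<comment> \<open>a crossing occurs only at \<open>r = m - 1\<close> or at \<open>r = l - 1\<close>\<close>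
    have "l dvd 2 * (?r z + 1)"
    proof (cases "?r z + 1 = l")
      case False
      then have "(?r z + 1) mod l = ?r z + 1" using r by auto
      then have "?r z + 1 = m" using c' by auto
      then show ?thesis using lm by simp
    qed simp
    moreover define q where "q = (z i - c - 1) div l"
    have "z i - c - 1 = l * q + ?r z" unfolding q_def by (rule mult_div_mod_eq[symmetric])
    then have "2 * (z i - c) = 2 * (?r z + 1) + l * (2 * q)" by algebra
    ultimately have "l dvd 2 * (z i - c)" by simp
    then have "(z i + 1) mod l = (2 * c + 1 - z i) mod l"
      by (simp add: mod_eq_dvd_iff algebra_simps)
    then have "torus_step L i z = ?\<theta> z" by (simp add: torus_step_def l_def)
    moreover have "?\<theta> (?\<theta> z) = z" using inv[OF z] .
    ultimately show ?thesis unfolding \<open>j = i\<close> by simp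
  qed
  show ?thesis
    unfolding bond_reflection_def
  proof (intro conjI ballI)
    fix e assume e: "e \<in> ?E"
    obtain x y where xy: "e = (x, y)" by fastforce
    obtain z j where z: "z \<in> ?V" "j < d" "(x, y) = (z, torus_step L j z) \<or> (x, y) = (torus_step L j z, z)"
      using e xy torus_bonds_cases by metis
    from z(3) consider "x = z" "y = torus_step L j z" | "x = torus_step L j z" "y = z" by auto
    then have "(?\<theta> x, ?\<theta> y) \<in> ?E \<and> ((x \<in> ?P \<longleftrightarrow> y \<notin> ?P) \<longrightarrow> y = ?\<theta> x)"
    proof cases
      case 1
      show ?thesis unfolding 1 using E\<theta>[OF z(1,2)] cross[OF z(1,2)] by blast
    next
      case 2
      show ?thesis unfolding 2 using E\<theta>[OF z(1,2)] cross[OF z(1,2)] by blast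
    qed
    then show "case e of (x, y) \<Rightarrow> (?\<theta> x, ?\<theta> y) \<in> ?E \<and> ((x \<in> ?P \<longleftrightarrow> y \<notin> ?P) \<longrightarrow> y = ?\<theta> x)"
      unfolding xy prod.case .
  next
    show "?P \<subseteq> ?V" by auto
  qed (use \<theta>V inv flipP in blast)+
qed

lemma torus_bond_crossed:
  assumes L: "even L" "0 < L" and xy: "(x, y) \<in> torus_bonds d L"
  shows "\<exists>P \<theta>. bond_reflection (torus d L) (torus_bonds d L) P \<theta> \<and> (x \<in> P \<longleftrightarrow> y \<notin> P)"
proof -
  obtain z i where z: "z \<in> torus d L" "i < d" "(x, y) = (z, torus_step L i z) \<or> (x, y) = (torus_step L i z, z)"
    using xy torus_bonds_cases by metis
  let ?P = "{w \<in> torus d L. (w i - z i - 1) mod int L < int (L div 2)}"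
  have s: "torus_step L i z \<in> torus d L" using torus_step_in_torus L(2) z by blast
  have half: "0 < int (L div 2)" "int (L div 2) \<le> int L - 1" using L by (auto elim!: evenE)
  have "(- 1) mod int L = int L - 1" using mod_reflect[of "int L" 0] L by simp
  then have "z \<notin> ?P" using half by auto
  moreover have "((z i + 1) mod int L - z i - 1) mod int L = 0"
    by (simp add: mod_simps diff_diff_eq)
  then have "torus_step L i z \<in> ?P" using s half by (auto simp: torus_step_def)
  ultimately have "x \<in> ?P \<longleftrightarrow> y \<notin> ?P" using z(3) by auto
  then show ?thesis using torus_bond_reflection[OF L z(2), of "z i"] by blast
qed

section \<open>The spin model as a Gaussian gradient weight\<close>

lemma sphere_measure_id_measurable: "(\<lambda>v. v) \<in> borel_measurable (sphere_measure :: (real ^ 'n) measure)"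
  by (subst measurable_cong_sets[OF sets_sphere_measure refl]) (rule measurable_restrict_space1, simp)

lemma spin_measurable [measurable]:
  assumes "x \<in> torus d L"
  shows "(\<lambda>\<phi>. \<phi> x) \<in> borel_measurable (spin_measure d L :: 'n::finite spin_config measure)"
  unfolding spin_measure_def
  by (rule measurable_compose[OF measurable_component_singleton[OF assms, of "\<lambda>_. sphere_measure"]
        sphere_measure_id_measurable])

lemma norm_spin:
  "\<phi> \<in> space (spin_measure d L :: 'n::finite spin_config measure) \<Longrightarrow> x \<in> torus d L \<Longrightarrow> norm (\<phi> x) = 1"
  by (auto simp: spin_measure_def space_PiM space_sphere_measure PiE_iff)

lemma prob_space_spin_measure: "prob_space (spin_measure d L :: 'n::finite spin_config measure)"
  unfolding spin_measure_def by (rule prob_space_PiM) (rule prob_space_sphere_measure)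

definition bond_energy :: "nat \<Rightarrow> nat \<Rightarrow> 'n::finite spin_config \<Rightarrow> real" where
  "bond_energy d L = gradient_energy (torus_bonds d L) (\<lambda>_. 0)"

lemma bond_energy_measurable [measurable]:
  "0 < L \<Longrightarrow> bond_energy d L \<in> borel_measurable (spin_measure d L :: 'n::finite spin_config measure)"
  unfolding bond_energy_def spin_measure_def
  by (rule gradient_energy_measurable[OF sphere_measure_id_measurable torus_bonds_subset])

lemma finite_torus_bonds: "0 < L \<Longrightarrow> finite (torus_bonds d L)"
  using torus_bonds_subset finite_torus by (metis finite_SigmaI finite_subset)

lemma bond_energy_bounds:
  assumes "0 < L" "\<phi> \<in> space (spin_measure d L :: 'n::finite spin_config measure)"
  shows "0 \<le> bond_energy d L \<phi>" "bond_energy d L \<phi> \<le> 4 * card (torus_bonds d L)"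
proof -
  show "0 \<le> bond_energy d L \<phi>"
    unfolding bond_energy_def gradient_energy_def by (intro sum_nonneg) auto
  have "bond_energy d L \<phi> \<le> (\<Sum>e\<in>torus_bonds d L. 4)"
    unfolding bond_energy_def gradient_energy_def
  proof (intro sum_mono)
    fix e assume e: "e \<in> torus_bonds d L"
    obtain x y where xy: "e = (x, y)" by fastforce
    then have "norm (\<phi> x) = 1" "norm (\<phi> y) = 1"
      using e torus_bonds_subset[OF assms(1)] norm_spin[OF assms(2)] by blast+
    then have "norm (\<phi> x - \<phi> y) \<le> 2"
      using norm_triangle_ineq4[of "\<phi> x" "\<phi> y"] by simp
    then have "(norm (\<phi> x - \<phi> y))\<^sup>2 \<le> 2\<^sup>2" by (intro power_mono) auto
    then show "(case e of (x, y) \<Rightarrow> (norm (\<phi> x - \<phi> y + 0))\<^sup>2) \<le> 4" by (simp add: xy)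
  qed
  then show "bond_energy d L \<phi> \<le> 4 * card (torus_bonds d L)" by simp
qed

text \<open>
  For \<open>L \<ge> 2\<close> the two ends of an edge are distinct, so each edge carries exactly two ordered bonds.
\<close>

lemma sum_torus_bonds:
  assumes L: "2 \<le> L"
  shows "(\<Sum>(x, y)\<in>torus_bonds d L. g {x, y}) = 2 * (\<Sum>e\<in>torus_edges d L. g e :: real)"
proof -
  let ?E = "torus_bonds d L" and ?u = "\<lambda>(x, y). {x, y :: site}"
  have fin: "finite ?E" using L finite_torus_bonds by simp
  have img: "?u ` ?E = torus_edges d L"
  proof (intro equalityI subsetI)
    fix e assume "e \<in> torus_edges d L"
    then obtain x i where "x \<in> torus d L" "i < d" "e = {x, torus_step L i x}"
      by (auto simp: torus_edges_def torus_step_def)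
    then show "e \<in> ?u ` ?E"
      using torus_bondsI(1)[of x d L i] by (intro image_eqI[of _ _ "(x, torus_step L i x)"]) simp_all
  qed (auto simp: torus_bonds_def)
  then have finT: "finite (torus_edges d L)" using fin by (metis finite_imageI)
  have "(\<Sum>(x, y)\<in>?E. g {x, y}) = (\<Sum>p\<in>?E. g (?u p))" by (simp add: split_beta)
  also have "\<dots> = (\<Sum>e\<in>torus_edges d L. \<Sum>p\<in>{p \<in> ?E. ?u p = e}. g (?u p))"
    using sum.group[OF fin finT, of ?u "\<lambda>p. g (?u p)"] img by simp
  also have "\<dots> = (\<Sum>e\<in>torus_edges d L. 2 * g e)"
  proof (rule sum.cong[OF refl])
    fix e assume e: "e \<in> torus_edges d L"
    then obtain x i where x: "x \<in> torus d L" "i < d" and exy: "e = {x, torus_step L i x}"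
      by (auto simp: torus_edges_def torus_step_def)
    have ne: "torus_step L i x \<noteq> x" using torus_step_neq[OF L x] .
    have "{p \<in> ?E. ?u p = e} = {(x, torus_step L i x), (torus_step L i x, x)}"
    proof -
      have "{p \<in> ?E. ?u p = {x, s}} = {(x, s), (s, x)}" if "(x, s) \<in> ?E" "(s, x) \<in> ?E" for s
        using that by (auto simp: doubleton_eq_iff)
      from this[OF torus_bondsI[OF x]] show ?thesis by (simp only: exy)
    qed
    then have "(\<Sum>p\<in>{p \<in> ?E. ?u p = e}. g (?u p)) = (\<Sum>p\<in>{(x, torus_step L i x), (torus_step L i x, x)}. g (?u p))"
      by simp
    also have "\<dots> = 2 * g e" using ne by (simp add: exy insert_commute)
    finally show "(\<Sum>p\<in>{p \<in> ?E. ?u p = e}. g (?u p)) = 2 * g e" .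
  qed
  finally show ?thesis by (simp add: sum_distrib_left)
qed

text \<open>
  On unit vectors \<open>\<bar>\<phi>\<^sub>x - \<phi>\<^sub>y\<bar>\<^sup>2 = 2 - 2 \<phi>\<^sub>x \<bullet> \<phi>\<^sub>y\<close>.
\<close>

lemma hamiltonian_eq_bond_energy:
  assumes L: "2 \<le> L" and \<phi>: "\<phi> \<in> space (spin_measure d L :: 'n::finite spin_config measure)"
  shows "hamiltonian d L \<phi> = bond_energy d L \<phi> / 4 - card (torus_bonds d L) / 2"
proof -
  let ?E = "torus_bonds d L"
  have "bond_energy d L \<phi> = (\<Sum>(x, y)\<in>?E. 2 - 2 * edge_inner \<phi> {x, y})"
    unfolding bond_energy_def gradient_energy_def
  proof (intro sum.cong refl)
    fix e assume e: "e \<in> ?E"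
    obtain x y where xy: "e = (x, y)" by fastforce
    have "norm (\<phi> x) = 1" "norm (\<phi> y) = 1"
      using e torus_bonds_subset[of L d] norm_spin[OF \<phi>] L xy by auto
    then have "(norm (\<phi> x - \<phi> y))\<^sup>2 = 2 - 2 * (\<phi> x \<bullet> \<phi> y)"
      by (simp add: power2_norm_eq_inner inner_diff inner_commute norm_eq_1)
    then show "(case e of (x, y) \<Rightarrow> (norm (\<phi> x - \<phi> y + 0))\<^sup>2) = (case e of (x, y) \<Rightarrow> 2 - 2 * edge_inner \<phi> {x, y})"
      by (simp add: xy)
  qed
  also have "\<dots> = 2 * card ?E - 2 * (\<Sum>(x, y)\<in>?E. edge_inner \<phi> {x, y})"
    by (simp add: split_beta sum_subtractf sum_distrib_left)
  finally show ?thesis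
    unfolding sum_torus_bonds[OF L] hamiltonian_def by (simp add: field_simps)
qed

lemma spin_expectation_eq:
  fixes f :: "'n::finite spin_config \<Rightarrow> real"
  assumes L: "2 \<le> L"
  shows "spin_expectation d L \<beta> f =
    (\<integral>\<phi>. f \<phi> * exp (- (\<beta> / 4) * bond_energy d L \<phi>) \<partial>spin_measure d L) /
    (\<integral>\<phi>. exp (- (\<beta> / 4) * bond_energy d L \<phi>) \<partial>(spin_measure d L :: 'n spin_config measure))"
proof -
  define c where "c = exp (\<beta> * card (torus_bonds d L) / 2)"
  have w: "exp (- \<beta> * hamiltonian d L \<phi>) = c * exp (- (\<beta> / 4) * bond_energy d L \<phi>)"
    if "\<phi> \<in> space (spin_measure d L :: 'n spin_config measure)" for \<phi>
    unfolding hamiltonian_eq_bond_energy[OF L that] c_def mult_exp_exp by (simp add: algebra_simps)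
  have int: "(\<integral>\<phi>. g \<phi> * exp (- \<beta> * hamiltonian d L \<phi>) \<partial>spin_measure d L)
    = c * (\<integral>\<phi>. g \<phi> * exp (- (\<beta> / 4) * bond_energy d L \<phi>) \<partial>spin_measure d L)"
    for g :: "'n spin_config \<Rightarrow> real"
  proof -
    have "(\<integral>\<phi>. g \<phi> * exp (- \<beta> * hamiltonian d L \<phi>) \<partial>spin_measure d L)
      = (\<integral>\<phi>. c * (g \<phi> * exp (- (\<beta> / 4) * bond_energy d L \<phi>)) \<partial>spin_measure d L)"
      by (intro Bochner_Integration.integral_cong refl) (simp only: w mult_ac)
    then show ?thesis by simp
  qed
  show ?thesis
    using int[of f] int[of "\<lambda>_. 1"] by (simp add: spin_expectation_def c_def)
qed

definition bounded_observable :: "nat \<Rightarrow> nat \<Rightarrow> ('n::finite spin_config \<Rightarrow> 'b::real_normed_vector) \<Rightarrow> bool" where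
  "bounded_observable d L f \<longleftrightarrow> f \<in> borel_measurable (spin_measure d L) \<and>
     (\<exists>K. \<forall>\<phi>\<in>space (spin_measure d L). norm (f \<phi>) \<le> K)"

lemma integrable_bounded_observable:
  fixes f :: "'n::finite spin_config \<Rightarrow> real"
  assumes L: "0 < L" and \<beta>: "0 \<le> \<beta>" and f: "bounded_observable d L f"
  shows "integrable (spin_measure d L) (\<lambda>\<phi>. f \<phi> * exp (- (\<beta> / 4) * bond_energy d L \<phi>))"
proof -
  interpret prob_space "spin_measure d L :: 'n spin_config measure" by (rule prob_space_spin_measure)
  obtain K where K: "\<And>\<phi>. \<phi> \<in> space (spin_measure d L) \<Longrightarrow> norm (f \<phi>) \<le> K"
    and [measurable]: "f \<in> borel_measurable (spin_measure d L)" using f by (auto simp: bounded_observable_def)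
  note [measurable] = bond_energy_measurable[OF L]
  show ?thesis
  proof (rule integrable_const_bound[of _ K])
    show "AE \<phi> in spin_measure d L. norm (f \<phi> * exp (- (\<beta> / 4) * bond_energy d L \<phi>)) \<le> K"
    proof (rule AE_I2)
      fix \<phi> :: "'n spin_config" assume \<phi>: "\<phi> \<in> space (spin_measure d L)"
      have "norm (f \<phi> * exp (- (\<beta> / 4) * bond_energy d L \<phi>)) = norm (f \<phi>) * exp (- (\<beta> / 4) * bond_energy d L \<phi>)"
        by (simp add: abs_mult)
      also have "\<dots> \<le> norm (f \<phi>) * 1"
        using \<beta> bond_energy_bounds(1)[OF L \<phi>] by (intro mult_left_mono) auto
      finally show "norm (f \<phi> * exp (- (\<beta> / 4) * bond_energy d L \<phi>)) \<le> K" using K[OF \<phi>] by simp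
    qed
  qed measurable
qed

lemma partition_function_pos:
  assumes L: "0 < L" and \<beta>: "0 \<le> \<beta>"
  shows "0 < (\<integral>\<phi>. exp (- (\<beta> / 4) * bond_energy d L \<phi>) \<partial>(spin_measure d L :: 'n::finite spin_config measure))"
proof -
  interpret prob_space "spin_measure d L :: 'n spin_config measure" by (rule prob_space_spin_measure)
  have "exp (- (\<beta> / 4) * (4 * card (torus_bonds d L)))
      \<le> (\<integral>\<phi>. exp (- (\<beta> / 4) * bond_energy d L \<phi>) \<partial>(spin_measure d L :: 'n::finite spin_config measure))"
  proof (rule integral_ge_const)
    have "bounded_observable d L (\<lambda>_ :: 'n spin_config. 1 :: real)"
      by (auto simp: bounded_observable_def)
    from integrable_bounded_observable[OF L \<beta> this]
    show "integrable (spin_measure d L) (\<lambda>\<phi> :: 'n spin_config. exp (- (\<beta> / 4) * bond_energy d L \<phi>))" by simp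
    show "AE \<phi> in spin_measure d L :: 'n spin_config measure.
        exp (- (\<beta> / 4) * (4 * card (torus_bonds d L))) \<le> exp (- (\<beta> / 4) * bond_energy d L \<phi>)"
    proof (rule AE_I2)
      fix \<phi> :: "'n spin_config" assume \<phi>: "\<phi> \<in> space (spin_measure d L)"
      have "- (\<beta> / 4) * (4 * card (torus_bonds d L)) \<le> - (\<beta> / 4) * bond_energy d L \<phi>"
        using \<beta> bond_energy_bounds(2)[OF L \<phi>] by (intro mult_left_mono_neg) auto
      then show "exp (- (\<beta> / 4) * (4 * card (torus_bonds d L))) \<le> exp (- (\<beta> / 4) * bond_energy d L \<phi>)" by simp
    qed
  qed
  then show ?thesis by (rule less_le_trans[OF exp_gt_zero])
qed

lemma spin_expectation_mono:
  fixes f g :: "'n::finite spin_config \<Rightarrow> real"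
  assumes L: "2 \<le> L" and \<beta>: "0 \<le> \<beta>" and "bounded_observable d L f" "bounded_observable d L g"
    and "\<And>\<phi>. \<phi> \<in> space (spin_measure d L) \<Longrightarrow> f \<phi> \<le> g \<phi>"
  shows "spin_expectation d L \<beta> f \<le> spin_expectation d L \<beta> g"
proof -
  have L0: "0 < L" using L by simp
  show ?thesis
    unfolding spin_expectation_eq[OF L]
    using partition_function_pos[OF L0 \<beta>, of d, where 'n = 'n] assms
    by (intro divide_right_mono integral_mono integrable_bounded_observable mult_right_mono) auto
qed

lemma spin_expectation_sum:
  fixes f :: "'i \<Rightarrow> 'n::finite spin_config \<Rightarrow> real"
  assumes L: "2 \<le> L" and \<beta>: "0 \<le> \<beta>" and f: "\<And>i. i \<in> I \<Longrightarrow> bounded_observable d L (f i)"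
  shows "spin_expectation d L \<beta> (\<lambda>\<phi>. \<Sum>i\<in>I. c i * f i \<phi>) = (\<Sum>i\<in>I. c i * spin_expectation d L \<beta> (f i))"
proof -
  have int: "integrable (spin_measure d L) (\<lambda>\<phi>. f i \<phi> * exp (- (\<beta> / 4) * bond_energy d L \<phi>))"
    if "i \<in> I" for i
    using L by (intro integrable_bounded_observable \<beta> f that) simp
  have "(\<integral>\<phi>. (\<Sum>i\<in>I. c i * f i \<phi>) * exp (- (\<beta> / 4) * bond_energy d L \<phi>) \<partial>spin_measure d L)
    = (\<integral>\<phi>. (\<Sum>i\<in>I. c i * (f i \<phi> * exp (- (\<beta> / 4) * bond_energy d L \<phi>))) \<partial>spin_measure d L)"
    by (simp add: sum_distrib_right mult.assoc)
  also have "\<dots> = (\<Sum>i\<in>I. c i * (\<integral>\<phi>. f i \<phi> * exp (- (\<beta> / 4) * bond_energy d L \<phi>) \<partial>spin_measure d L))"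
    by (subst Bochner_Integration.integral_sum) (simp_all only: integrable_mult_right int integral_mult_right_zero)
  finally show ?thesis
    unfolding spin_expectation_eq[OF L] by (simp add: sum_divide_distrib)
qed

lemma spin_expectation_lincomb:
  fixes f g :: "'n::finite spin_config \<Rightarrow> real"
  assumes "2 \<le> L" "0 \<le> \<beta>" "bounded_observable d L f" "bounded_observable d L g"
  shows "spin_expectation d L \<beta> (\<lambda>\<phi>. a * f \<phi> + b * g \<phi>) = a * spin_expectation d L \<beta> f + b * spin_expectation d L \<beta> g"
  using spin_expectation_sum[of L \<beta> "UNIV :: bool set" d "\<lambda>t. if t then f else g" "\<lambda>t. if t then a else b"] assms
  by (simp add: UNIV_bool add.commute)

lemma spin_expectation_const:
  assumes "2 \<le> L" "0 \<le> \<beta>"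
  shows "spin_expectation d L \<beta> (\<lambda>_ :: 'n::finite spin_config. c) = c"
  unfolding spin_expectation_eq[OF assms(1)]
  using partition_function_pos[of L \<beta> d, where 'n = 'n] assms by simp

section \<open>Mean-square bounds and the infrared bound on the torus\<close>

lemma bounded_observable_spin:
  "x \<in> torus d L \<Longrightarrow> bounded_observable d L (\<lambda>\<phi> :: 'n::finite spin_config. \<phi> x)"
  unfolding bounded_observable_def by (intro conjI exI[of _ 1]) (auto simp: norm_spin)

lemma bounded_observable_add:
  fixes f g :: "'n::finite spin_config \<Rightarrow> 'b::{real_normed_vector, second_countable_topology}"
  assumes "bounded_observable d L f" "bounded_observable d L g"
  shows "bounded_observable d L (\<lambda>\<phi>. f \<phi> + g \<phi>)"
proof -
  obtain K K' where [measurable]: "f \<in> borel_measurable (spin_measure d L)" "g \<in> borel_measurable (spin_measure d L)"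
    and K: "\<And>\<phi>. \<phi> \<in> space (spin_measure d L) \<Longrightarrow> norm (f \<phi>) \<le> K"
      "\<And>\<phi>. \<phi> \<in> space (spin_measure d L) \<Longrightarrow> norm (g \<phi>) \<le> K'"
    using assms by (auto simp: bounded_observable_def)
  show ?thesis unfolding bounded_observable_def
    by (intro conjI exI[of _ "K + K'"] ballI) (measurable, auto intro!: norm_triangle_mono K)
qed

lemma bounded_observable_scaleR:
  fixes f :: "'n::finite spin_config \<Rightarrow> 'b::{real_normed_vector, second_countable_topology}"
  assumes "bounded_observable d L f"
  shows "bounded_observable d L (\<lambda>\<phi>. c *\<^sub>R f \<phi>)"
proof -
  obtain K where [measurable]: "f \<in> borel_measurable (spin_measure d L)"
    and K: "\<And>\<phi>. \<phi> \<in> space (spin_measure d L) \<Longrightarrow> norm (f \<phi>) \<le> K"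
    using assms by (auto simp: bounded_observable_def)
  show ?thesis unfolding bounded_observable_def
    by (intro conjI exI[of _ "\<bar>c\<bar> * K"] ballI) (measurable, auto intro!: mult_left_mono K)
qed

lemma bounded_observable_diff:
  fixes f g :: "'n::finite spin_config \<Rightarrow> 'b::{real_normed_vector, second_countable_topology}"
  assumes "bounded_observable d L f" "bounded_observable d L g"
  shows "bounded_observable d L (\<lambda>\<phi>. f \<phi> - g \<phi>)"
  using bounded_observable_add[OF assms(1) bounded_observable_scaleR[OF assms(2), of "-1"]] by simp

lemma bounded_observable_sum:
  fixes f :: "'i \<Rightarrow> 'n::finite spin_config \<Rightarrow> 'b::{real_normed_vector, second_countable_topology}"
  assumes "\<And>i. i \<in> I \<Longrightarrow> bounded_observable d L (f i)"
  shows "bounded_observable d L (\<lambda>\<phi>. \<Sum>i\<in>I. f i \<phi>)"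
proof -
  have zero: "bounded_observable d L (\<lambda>_ :: 'n spin_config. 0 :: 'b)"
    by (auto simp: bounded_observable_def)
  show ?thesis using assms
    by (induction I rule: infinite_finite_induct) (auto intro: zero bounded_observable_add)
qed

lemma bounded_observable_norm_square:
  fixes f :: "'n::finite spin_config \<Rightarrow> 'b::{real_normed_vector, second_countable_topology}"
  assumes "bounded_observable d L f"
  shows "bounded_observable d L (\<lambda>\<phi>. (norm (f \<phi>))\<^sup>2)"
proof -
  obtain K where [measurable]: "f \<in> borel_measurable (spin_measure d L)"
    and K: "\<And>\<phi>. \<phi> \<in> space (spin_measure d L) \<Longrightarrow> norm (f \<phi>) \<le> K"
    using assms by (auto simp: bounded_observable_def)
  show ?thesis unfolding bounded_observable_def
    by (intro conjI exI[of _ "K\<^sup>2"] ballI) (measurable, auto intro!: power_mono K)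
qed

lemma bounded_observable_inner:
  fixes f g :: "'n::finite spin_config \<Rightarrow> 'b::euclidean_space"
  assumes "bounded_observable d L f" "bounded_observable d L g"
  shows "bounded_observable d L (\<lambda>\<phi>. f \<phi> \<bullet> g \<phi>)"
proof -
  have "f \<phi> \<bullet> g \<phi> = (1 / 2) *\<^sub>R ((norm (f \<phi> + g \<phi>))\<^sup>2 - ((norm (f \<phi>))\<^sup>2 + (norm (g \<phi>))\<^sup>2))" for \<phi>
    by (simp add: power2_norm_eq_inner inner_add inner_commute)
  then show ?thesis
    using assms by (simp only:) (intro bounded_observable_scaleR bounded_observable_diff
        bounded_observable_norm_square bounded_observable_add)
qed

text \<open>
  An upper bound on the \<open>L\<^sup>2\<close> norm of an observable in the spin model. Boundedness and measurability are part
  of the notion, so that integrability never has to be discussed again.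
\<close>

definition mean_square_le ::
    "nat \<Rightarrow> nat \<Rightarrow> real \<Rightarrow> ('n::finite spin_config \<Rightarrow> real ^ 'n) \<Rightarrow> real \<Rightarrow> bool" where
  "mean_square_le d L \<beta> f r \<longleftrightarrow> bounded_observable d L f \<and>
     spin_expectation d L \<beta> (\<lambda>\<phi>. (norm (f \<phi>))\<^sup>2) \<le> r\<^sup>2"

text \<open>
  Minkowski's inequality. For positive \<open>r\<close> and \<open>s\<close> it follows by averaging the pointwise
  \<open>(a + b)\<^sup>2 \<le> (1 + s / r) a\<^sup>2 + (1 + r / s) b\<^sup>2\<close>.
\<close>

lemma mean_square_le_add:
  assumes L: "2 \<le> L" and \<beta>: "0 \<le> \<beta>" and f: "mean_square_le d L \<beta> f r" and g: "mean_square_le d L \<beta> g s"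
    and r: "0 < r" and s: "0 < s"
  shows "mean_square_le d L \<beta> (\<lambda>\<phi>. f \<phi> + g \<phi>) (r + s)"
proof -
  have bo: "bounded_observable d L f" "bounded_observable d L g"
    using f g by (auto simp: mean_square_le_def)
  note n2 = bounded_observable_norm_square[OF bo(1)] bounded_observable_norm_square[OF bo(2)]
  have "spin_expectation d L \<beta> (\<lambda>\<phi>. (norm (f \<phi> + g \<phi>))\<^sup>2)
      \<le> spin_expectation d L \<beta> (\<lambda>\<phi>. (1 + s / r) * (norm (f \<phi>))\<^sup>2 + (1 + r / s) * (norm (g \<phi>))\<^sup>2)"
  proof (rule spin_expectation_mono[OF L \<beta>])
    show "bounded_observable d L (\<lambda>\<phi>. (norm (f \<phi> + g \<phi>))\<^sup>2)"
      by (intro bounded_observable_norm_square bounded_observable_add bo)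
    show "bounded_observable d L (\<lambda>\<phi>. (1 + s / r) * (norm (f \<phi>))\<^sup>2 + (1 + r / s) * (norm (g \<phi>))\<^sup>2)"
      unfolding real_scaleR_def[symmetric] by (intro bounded_observable_add bounded_observable_scaleR n2)
  next
    fix \<phi>
    let ?a = "norm (f \<phi>)" and ?b = "norm (g \<phi>)"
    have "(norm (f \<phi> + g \<phi>))\<^sup>2 \<le> (?a + ?b)\<^sup>2" by (intro power_mono norm_triangle_ineq) auto
    also have "(1 + s / r) * ?a\<^sup>2 + (1 + r / s) * ?b\<^sup>2 - (?a + ?b)\<^sup>2 = (s * ?a - r * ?b)\<^sup>2 / (r * s)"
      using r s by (simp add: field_simps power2_eq_square)
    then have "(?a + ?b)\<^sup>2 \<le> (1 + s / r) * ?a\<^sup>2 + (1 + r / s) * ?b\<^sup>2"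
      using r s by (smt (verit) divide_nonneg_pos mult_pos_pos zero_le_power2)
    finally show "(norm (f \<phi> + g \<phi>))\<^sup>2 \<le> (1 + s / r) * ?a\<^sup>2 + (1 + r / s) * ?b\<^sup>2" .
  qed
  also have "\<dots> = (1 + s / r) * spin_expectation d L \<beta> (\<lambda>\<phi>. (norm (f \<phi>))\<^sup>2)
      + (1 + r / s) * spin_expectation d L \<beta> (\<lambda>\<phi>. (norm (g \<phi>))\<^sup>2)"
    by (rule spin_expectation_lincomb[OF L \<beta> n2])
  also have "\<dots> \<le> (1 + s / r) * r\<^sup>2 + (1 + r / s) * s\<^sup>2"
    using f g r s by (intro add_mono mult_left_mono) (auto simp: mean_square_le_def)
  also have "\<dots> = (r + s)\<^sup>2" using r s by (simp add: field_simps power2_eq_square)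
  finally show ?thesis
    using bo by (simp add: mean_square_le_def bounded_observable_add)
qed

lemma mean_square_le_scaleR:
  assumes L: "2 \<le> L" and \<beta>: "0 \<le> \<beta>" and f: "mean_square_le d L \<beta> f r"
  shows "mean_square_le d L \<beta> (\<lambda>\<phi>. c *\<^sub>R f \<phi>) (c * r)"
proof -
  have bo: "bounded_observable d L f" using f by (simp add: mean_square_le_def)
  have "spin_expectation d L \<beta> (\<lambda>\<phi>. (norm (c *\<^sub>R f \<phi>))\<^sup>2) = c\<^sup>2 * spin_expectation d L \<beta> (\<lambda>\<phi>. (norm (f \<phi>))\<^sup>2)"
    using spin_expectation_sum[OF L \<beta>, of "{()}" d "\<lambda>_ \<phi>. (norm (f \<phi>))\<^sup>2" "\<lambda>_. c\<^sup>2"]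
      bounded_observable_norm_square[OF bo] by (simp add: power_mult_distrib)
  also have "\<dots> \<le> (c * r)\<^sup>2"
    using f by (simp add: mean_square_le_def power_mult_distrib mult_left_mono)
  finally show ?thesis using bo by (simp add: mean_square_le_def bounded_observable_scaleR)
qed

lemma mean_square_le_mono:
  "mean_square_le d L \<beta> f r \<Longrightarrow> 0 \<le> r \<Longrightarrow> r \<le> s \<Longrightarrow> mean_square_le d L \<beta> f s"
  unfolding mean_square_le_def by (meson order_trans power_mono)

lemma mean_square_le_zero:
  assumes "2 \<le> L" "0 \<le> \<beta>"
  shows "mean_square_le d L \<beta> (\<lambda>_. 0 :: real ^ 'n::finite) r"
  using spin_expectation_const[OF assms, of d 0, where 'n = 'n] by (auto simp: mean_square_le_def bounded_observable_def)

text \<open>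
  The infrared bound for the field that equals a basis vector \<open>v\<close> on the bonds leaving \<open>B\<close> in direction \<open>i\<close>
  and vanishes elsewhere, summed over \<open>v\<close>.
\<close>

lemma infrared_bound_torus:
  fixes B :: "site set"
  assumes L: "even L" "2 \<le> L" and \<beta>: "0 < \<beta>" and B: "B \<subseteq> torus d L" and i: "i < d"
  shows "mean_square_le d L \<beta> (\<lambda>\<phi> :: 'n::finite spin_config. \<Sum>x\<in>B. \<phi> x - \<phi> (torus_step L i x))
    (sqrt (4 * DIM(real ^ 'n) / \<beta>) * sqrt (card B))"
proof -
  let ?E = "torus_bonds d L" and ?\<mu> = "spin_measure d L :: 'n spin_config measure"
  let ?S = "\<lambda>\<phi> :: 'n spin_config. \<Sum>x\<in>B. \<phi> x - \<phi> (torus_step L i x)"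
  have L0: "0 < L" and \<beta>0: "0 \<le> \<beta>" and k: "0 < \<beta> / 4" using L \<beta> by auto
  have bo: "bounded_observable d L ?S"
    using B i torus_step_in_torus[OF L0]
    by (intro bounded_observable_sum bounded_observable_diff bounded_observable_spin) auto
  have comp: "spin_expectation d L \<beta> (\<lambda>\<phi>. (?S \<phi> \<bullet> v)\<^sup>2) \<le> 4 * card B / \<beta>"
    and boc: "bounded_observable d L (\<lambda>\<phi>. (?S \<phi> \<bullet> v)\<^sup>2)" if v: "v \<in> Basis" for v
  proof -
    define h where "h = (\<lambda>(x, y). if x \<in> B \<and> y = torus_step L i x then v else 0)"
    let ?T = "(\<lambda>x. (x, torus_step L i x)) ` B"
    have TE: "?T \<subseteq> ?E" using torus_bondsI(1) B i by auto
    have fin: "finite ?E" using finite_torus_bonds L0 by simp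
    have inj: "inj_on (\<lambda>x. (x, torus_step L i x)) B" by (auto intro: inj_onI)
    have A: "(\<Sum>(x, y)\<in>?E. (\<phi> x - \<phi> y) \<bullet> h (x, y)) = ?S \<phi> \<bullet> v" for \<phi> :: "'n spin_config"
    proof -
      have "(\<Sum>(x, y)\<in>?E. (\<phi> x - \<phi> y) \<bullet> h (x, y)) = (\<Sum>(x, y)\<in>?T. (\<phi> x - \<phi> y) \<bullet> h (x, y))"
        using fin TE by (intro sum.mono_neutral_right) (auto simp: h_def)
      also have "\<dots> = (\<Sum>x\<in>B. (\<phi> x - \<phi> (torus_step L i x)) \<bullet> v)"
        by (subst sum.reindex[OF inj]) (simp add: h_def)
      finally show ?thesis by (simp add: inner_sum_left)
    qed
    have Q: "(\<Sum>e\<in>?E. (norm (h e))\<^sup>2) = card B"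
    proof -
      have "(\<Sum>e\<in>?E. (norm (h e))\<^sup>2) = (\<Sum>e\<in>?T. (norm (h e))\<^sup>2)"
        using fin TE by (intro sum.mono_neutral_right) (auto simp: h_def)
      also have "\<dots> = (\<Sum>x\<in>B. 1)"
        using v by (subst sum.reindex[OF inj]) (simp add: h_def)
      finally show ?thesis by simp
    qed
    have "bounded_observable d L (\<lambda>_ :: 'n spin_config. v)" by (auto simp: bounded_observable_def)
    then have "bounded_observable d L (\<lambda>\<phi>. ?S \<phi> \<bullet> v)" by (rule bounded_observable_inner[OF bo])
    from bounded_observable_norm_square[OF this]
    show bos: "bounded_observable d L (\<lambda>\<phi>. (?S \<phi> \<bullet> v)\<^sup>2)" by simp
    let ?w = "\<lambda>\<phi> :: 'n spin_config. exp (- (\<beta> / 4) * bond_energy d L \<phi>)"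
    have int: "integrable ?\<mu> (\<lambda>\<phi>. (?S \<phi> \<bullet> v)\<^sup>2 * ?w \<phi>)" "integrable ?\<mu> (\<lambda>\<phi>. 1 * ?w \<phi>)"
      by (intro integrable_bounded_observable L0 \<beta>0 bos)
        (intro integrable_bounded_observable L0 \<beta>0, simp add: bounded_observable_def exI[of _ 1])
    have "(\<integral>\<^sup>+\<phi>. ennreal ((?S \<phi> \<bullet> v)\<^sup>2 * ?w \<phi>) \<partial>?\<mu>) \<le> ennreal (card B / (\<beta> / 4)) * (\<integral>\<^sup>+\<phi>. ennreal (1 * ?w \<phi>) \<partial>?\<mu>)"
      using infrared_bound[OF prob_space_sphere_measure sphere_measure_id_measurable finite_torus
          torus_bonds_subset[OF L0] k torus_bond_crossed[OF L(1) L0], of d h]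
      unfolding A Q spin_measure_def[symmetric] bond_energy_def[symmetric] by simp
    then have "ennreal (\<integral>\<phi>. (?S \<phi> \<bullet> v)\<^sup>2 * ?w \<phi> \<partial>?\<mu>) \<le> ennreal (card B / (\<beta> / 4)) * ennreal (\<integral>\<phi>. 1 * ?w \<phi> \<partial>?\<mu>)"
      by (subst (asm) (1 2) nn_integral_eq_integral) (use int in auto)
    then have le: "(\<integral>\<phi>. (?S \<phi> \<bullet> v)\<^sup>2 * ?w \<phi> \<partial>?\<mu>) \<le> card B / (\<beta> / 4) * (\<integral>\<phi>. ?w \<phi> \<partial>?\<mu>)"
      using \<beta> by (subst (asm) ennreal_mult[symmetric]) (auto simp: ennreal_le_iff)
    show "spin_expectation d L \<beta> (\<lambda>\<phi>. (?S \<phi> \<bullet> v)\<^sup>2) \<le> 4 * card B / \<beta>"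
      unfolding spin_expectation_eq[OF L(2)]
      using le partition_function_pos[OF L0 \<beta>0, of d, where 'n = 'n] by (simp add: pos_divide_le_eq mult.commute)
  qed
  have "spin_expectation d L \<beta> (\<lambda>\<phi>. (norm (?S \<phi>))\<^sup>2)
    = spin_expectation d L \<beta> (\<lambda>\<phi>. \<Sum>v\<in>Basis. 1 * (?S \<phi> \<bullet> v)\<^sup>2)"
    by (simp add: power2_norm_eq_sum_inner)
  also have "\<dots> = (\<Sum>v\<in>Basis. 1 * spin_expectation d L \<beta> (\<lambda>\<phi>. (?S \<phi> \<bullet> v)\<^sup>2))"
    by (rule spin_expectation_sum[OF L(2) \<beta>0 boc])
  also have "\<dots> \<le> (\<Sum>v\<in>(Basis :: (real ^ 'n) set). 4 * card B / \<beta>)"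
    using comp by (intro sum_mono) simp
  also have "\<dots> = (sqrt (4 * DIM(real ^ 'n) / \<beta>) * sqrt (card B))\<^sup>2"
    using \<beta> by (simp add: power_mult_distrib)
  finally show ?thesis using bo by (simp add: mean_square_le_def)
qed

section \<open>Comparing a block average with its translate\<close>

text \<open>
  Block geometry takes place on the lattice \<open>\<int>\<^sup>d\<close>; sites are reduced to the torus only when
  a spin is evaluated.
\<close>

definition wrap :: "nat \<Rightarrow> nat \<Rightarrow> site \<Rightarrow> site" where
  "wrap d L z = (\<lambda>i\<in>{..<d}. z i mod int L)"

definition shift :: "nat \<Rightarrow> int \<Rightarrow> site \<Rightarrow> site" where
  "shift i n z = z(i := z i + n)"

definition block_average :: "nat \<Rightarrow> nat \<Rightarrow> site set \<Rightarrow> 'n::finite spin_config \<Rightarrow> real ^ 'n" where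
  "block_average d L S \<phi> = (1 / card S) *\<^sub>R (\<Sum>z\<in>S. \<phi> (wrap d L z))"

text \<open>
  The root mean square that the infrared bound allows for a single one-step difference \<open>\<phi>\<^sub>x - \<phi>\<^sub>y\<close>; averages
  over \<open>n\<close> sites gain a factor \<open>1 / sqrt n\<close>.
\<close>

definition spin_wave_scale :: "nat \<Rightarrow> real \<Rightarrow> real" where
  "spin_wave_scale N \<beta> = sqrt (4 * N / \<beta>)"

lemma wrap_in_torus: "0 < L \<Longrightarrow> wrap d L z \<in> torus d L"
  by (auto simp: wrap_def torus_def)

lemma wrap_torus: "z \<in> torus d L \<Longrightarrow> wrap d L z = z"
  by (auto simp: wrap_def torus_def PiE_iff extensional_def fun_eq_iff)

lemma wrap_shift_1: "i < d \<Longrightarrow> wrap d L (shift i 1 z) = torus_step L i (wrap d L z)"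
  by (auto simp: wrap_def shift_def torus_step_def fun_eq_iff mod_simps)

lemma inj_shift: "inj_on (shift i n) S"
proof (rule inj_onI)
  fix x y assume "shift i n x = shift i n y"
  then have "shift i n x j = shift i n y j" for j by simp
  then have "x j = y j" for j by (metis add_right_imp_eq fun_upd_apply shift_def)
  then show "x = y" by (rule ext)
qed

lemma shift_shift: "shift i m (shift i n z) = shift i (m + n) z"
  by (simp add: shift_def add.commute add.left_commute)

lemma inj_wrap_shift:
  assumes "inj_on (wrap d L) S"
  shows "inj_on (wrap d L) (shift i n ` S)"
proof (rule inj_onI, elim imageE, hypsubst)
  fix x y assume xy: "x \<in> S" "y \<in> S" and eq: "wrap d L (shift i n x) = wrap d L (shift i n y)"
  have "x j mod int L = y j mod int L" if "j < d" for j
  proof -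
    have "shift i n x j mod int L = shift i n y j mod int L"
      using fun_cong[OF eq, of j] that by (simp add: wrap_def)
    then show ?thesis by (cases "j = i") (auto simp: shift_def mod_eq_dvd_iff)
  qed
  then have "wrap d L x = wrap d L y" by (auto simp: wrap_def fun_eq_iff)
  with assms xy show "shift i n x = shift i n y" by (auto dest: inj_onD)
qed

lemma block_average_shift:
  "block_average d L (shift i n ` S) \<phi> = (1 / card S) *\<^sub>R (\<Sum>z\<in>S. \<phi> (wrap d L (shift i n z)))"
  unfolding block_average_def by (simp add: card_image inj_shift sum.reindex)

lemma block_average_doubling:
  assumes S: "finite S" "S \<noteq> {}" and disj: "S \<inter> shift i n ` S = {}"
  shows "block_average d L S (\<phi> :: 'n::finite spin_config) - block_average d L (S \<union> shift i n ` S) \<phi>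
    = (1 / 2) *\<^sub>R (block_average d L S \<phi> - block_average d L (shift i n ` S) \<phi>)"
proof -
  have card: "card (S \<union> shift i n ` S) = 2 * card S"
    using S disj by (simp add: card_Un_disjoint card_image inj_shift)
  have "(\<Sum>z\<in>S \<union> shift i n ` S. \<phi> (wrap d L z)) = (\<Sum>z\<in>S. \<phi> (wrap d L z)) + (\<Sum>z\<in>shift i n ` S. \<phi> (wrap d L z))"
    using S disj by (intro sum.union_disjoint) auto
  moreover have "a *\<^sub>R x - (a / 2) *\<^sub>R (x + y) = (1 / 2) *\<^sub>R (a *\<^sub>R x - a *\<^sub>R y)" for a and x y :: "real ^ 'n"
    by (simp add: vec_eq_iff field_simps)
  moreover have "1 / real (2 * card S) = (1 / card S) / 2" by simp
  ultimately show ?thesis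
    unfolding block_average_def card card_image[OF inj_shift] by (simp only:)
qed

lemma spin_wave_scale_pos: "0 < N \<Longrightarrow> 0 < \<beta> \<Longrightarrow> 0 < spin_wave_scale N \<beta>"
  by (simp add: spin_wave_scale_def)

context
  fixes d L :: nat and \<beta> :: real
  assumes L: "even L" "2 \<le> L" and \<beta>: "0 < \<beta>"
begin

lemma mean_square_le_unit_shift:
  assumes S: "finite S" "S \<noteq> {}" and inj: "inj_on (wrap d L) S" and i: "i < d"
  shows "mean_square_le d L \<beta>
    (\<lambda>\<phi> :: 'n::finite spin_config. block_average d L S \<phi> - block_average d L (shift i 1 ` S) \<phi>)
    (spin_wave_scale CARD('n) \<beta> / sqrt (card S))"
proof -
  have "card S > 0" using S by (simp add: card_gt_0_iff)
  have eq: "block_average d L S \<phi> - block_average d L (shift i 1 ` S) \<phi>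
      = (1 / card S) *\<^sub>R (\<Sum>x\<in>wrap d L ` S. \<phi> x - \<phi> (torus_step L i x))" for \<phi> :: "'n spin_config"
    unfolding block_average_shift
    by (simp add: block_average_def sum.reindex[OF inj] wrap_shift_1[OF i] sum_subtractf scaleR_diff_right)
  have "wrap d L ` S \<subseteq> torus d L" using wrap_in_torus L by auto
  from mean_square_le_scaleR[OF L(2) _ infrared_bound_torus[OF L \<beta> this i], of "1 / card S"]
  have "mean_square_le d L \<beta> (\<lambda>\<phi> :: 'n spin_config. block_average d L S \<phi> - block_average d L (shift i 1 ` S) \<phi>)
    (1 / card S * (sqrt (4 * DIM(real ^ 'n) / \<beta>) * sqrt (card (wrap d L ` S))))"
    using \<beta> by (simp add: eq)
  moreover have "1 / card S * (sqrt (4 * DIM(real ^ 'n) / \<beta>) * sqrt (card (wrap d L ` S)))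
    = spin_wave_scale CARD('n) \<beta> / sqrt (card S)"
  proof -
    have "sqrt (card S) / card S = 1 / sqrt (card S)" using \<open>card S > 0\<close> by (simp add: field_simps)
    then have "1 / card S * (c * sqrt (card S)) = c / sqrt (card S)" for c :: real
      by (metis (no_types, opaque_lifting) mult.commute mult.left_commute mult.right_neutral times_divide_eq_right)
    then show ?thesis by (simp add: spin_wave_scale_def card_image[OF inj])
  qed
  ultimately show ?thesis by simp
qed

lemma mean_square_le_shift_pos:
  assumes S: "finite S" "S \<noteq> {}" and inj: "inj_on (wrap d L) S" and i: "i < d" and n: "0 < n"
  shows "mean_square_le d L \<beta>
    (\<lambda>\<phi> :: 'n::finite spin_config. block_average d L S \<phi> - block_average d L (shift i (int n) ` S) \<phi>)
    (n * (spin_wave_scale CARD('n) \<beta> / sqrt (card S)))"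
  using n
proof (induction n rule: nat_induct_non_zero)
  case 1
  then show ?case using mean_square_le_unit_shift[OF S inj i] by simp
next
  case (Suc n)
  let ?T = "shift i (int n) ` S" and ?r = "spin_wave_scale CARD('n) \<beta> / sqrt (card S)"
  have cT: "card ?T = card S" by (simp add: card_image inj_shift)
  have img: "shift i 1 ` ?T = shift i (int (Suc n)) ` S"
    by (simp add: image_image shift_shift add.commute)
  have r: "0 < ?r" using spin_wave_scale_pos[of "CARD('n)" \<beta>] \<beta> S by (simp add: card_gt_0_iff)
  have "mean_square_le d L \<beta> (\<lambda>\<phi> :: 'n spin_config. block_average d L ?T \<phi> - block_average d L (shift i 1 ` ?T) \<phi>) ?r"
    using mean_square_le_unit_shift[OF _ _ inj_wrap_shift[OF inj] i, of i "int n"] S unfolding cT by simp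
  note step = this
  have nr: "0 < n * ?r" using r Suc.hyps by (intro mult_pos_pos) auto
  have "mean_square_le d L \<beta> (\<lambda>\<phi> :: 'n spin_config. block_average d L S \<phi>
      - block_average d L (shift i (int (Suc n)) ` S) \<phi>) (n * ?r + ?r)"
    using mean_square_le_add[OF L(2) _ Suc.IH step nr r] \<beta> unfolding img by simp
  moreover have "n * ?r + ?r = real (Suc n) * ?r" by (simp only: of_nat_Suc distrib_right mult_1 add.commute)
  ultimately show ?case by (simp only:)
qed

text \<open>
  A shift by \<open>n\<close> is a sum of \<open>n\<close> unit shifts. Each of them involves \<open>card S\<close> distinct torus bonds,
  because \<open>S\<close> and its translates embed into the torus.
\<close>

lemma mean_square_le_shift:
  assumes S: "finite S" "S \<noteq> {}" and inj: "inj_on (wrap d L) S" and i: "i < d"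
    and n: "0 \<le> n" "real_of_int n \<le> K"
  shows "mean_square_le d L \<beta>
    (\<lambda>\<phi> :: 'n::finite spin_config. block_average d L S \<phi> - block_average d L (shift i n ` S) \<phi>)
    (K * (spin_wave_scale CARD('n) \<beta> / sqrt (card S)))"
proof (cases "n = 0")
  case True
  then have "shift i n ` S = S" by (simp add: shift_def)
  then show ?thesis using mean_square_le_zero[of L \<beta>] L \<beta> by simp
next
  case False
  let ?r = "spin_wave_scale CARD('n) \<beta> / sqrt (card S)"
  have r: "0 < ?r"
    using spin_wave_scale_pos[of "CARD('n)" \<beta>] \<beta> S by (simp add: card_gt_0_iff)
  have nat: "int (nat n) = n" "0 < nat n" "real (nat n) \<le> K" using False n by auto
  show ?thesis
  proof (rule mean_square_le_mono)
    show "mean_square_le d L \<beta>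
      (\<lambda>\<phi> :: 'n spin_config. block_average d L S \<phi> - block_average d L (shift i n ` S) \<phi>) (nat n * ?r)"
      using mean_square_le_shift_pos[OF S inj i nat(2)] unfolding nat(1) .
    show "0 \<le> nat n * ?r" by (rule mult_nonneg_nonneg[OF of_nat_0_le_iff less_imp_le[OF r]])
    show "nat n * ?r \<le> K * ?r" by (rule mult_right_mono[OF nat(3) less_imp_le[OF r]])
  qed
qed

end

section \<open>Blocks that double one side at a time\<close>

text \<open>
  After \<open>m\<close> doublings, carried out cyclically in the first three directions, a block has \<open>2\<^sup>m\<close> sites and
  its first three sides differ by at most a factor two. Step \<open>m\<close> doubles direction \<open>m mod 3\<close>, whose current
  length is \<open>2 ^ (m div 3)\<close>. Blocks stay one site thick in the remaining directions.
\<close>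

definition side :: "nat \<Rightarrow> nat \<Rightarrow> nat" where
  "side m j = (if j < 3 then 2 ^ ((m + 2 - j) div 3) else 1)"

definition block :: "site \<Rightarrow> nat \<Rightarrow> site set" where
  "block p m = {z. \<forall>j. p j \<le> z j \<and> z j < p j + int (side m j)}"

lemma side_0: "side 0 j = 1"
proof -
  have "(0 + 2 - j) div 3 = 0" by (rule div_less) linarith
  then show ?thesis unfolding side_def by (simp only: power_0 if_cancel)
qed

lemma side_Suc: "side (Suc m) j = (if j = m mod 3 then 2 * side m j else side m j)"
proof (cases "j < 3")
  case True
  define q r where "q = m div 3" and "r = m mod 3"
  have m: "m = 3 * q + r" "r < 3" unfolding q_def r_def by simp_all
  have floor: "a < 3 \<Longrightarrow> (3 * q + a) div 3 = q" "3 \<le> a \<Longrightarrow> a < 6 \<Longrightarrow> (3 * q + a) div 3 = Suc q" for a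
    by simp_all
  have eqs: "m + 2 - j = 3 * q + (r + 2 - j)" "Suc m + 2 - j = 3 * q + (r + 3 - j)"
    unfolding m(1) using True by simp_all
  consider "r < j" | "r = j" | "j < r" by linarith
  then have "(Suc m + 2 - j) div 3 = (m + 2 - j) div 3 + (if j = r then 1 else 0)"
  proof cases
    case 1
    then show ?thesis using floor(1)[of "r + 2 - j"] floor(1)[of "r + 3 - j"] eqs True by simp
  next
    case 2
    then show ?thesis using floor(1)[of "r + 2 - j"] floor(2)[of "r + 3 - j"] eqs by simp
  next
    case 3
    then show ?thesis using floor(2)[of "r + 2 - j"] floor(2)[of "r + 3 - j"] eqs m(2) by simp
  qed
  then show ?thesis using True unfolding side_def r_def[symmetric] by (cases "j = r") (simp_all only: if_True if_False power_add power_one_right mult.commute add_0_right simp_thms)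
next
  case False
  then have "j \<noteq> m mod 3" using mod_less_divisor[of 3 m] by linarith
  then show ?thesis using False by (simp add: side_def)
qed

lemma side_doubled: "side m (m mod 3) = 2 ^ (m div 3)"
proof -
  have "m mod 3 < 3" by simp
  moreover have "m + 2 - m mod 3 = 2 + 3 * (m div 3)" using mult_div_mod_eq[of 3 m] by linarith
  then have "(m + 2 - m mod 3) div 3 = m div 3" by (simp only: div_mult_self2)
  ultimately show ?thesis by (simp add: side_def)
qed

lemma side_le: "m \<le> 3 * k \<Longrightarrow> side m j \<le> 2 ^ k"
proof (cases "j < 3")
  case True
  assume "m \<le> 3 * k"
  then have "(m + 2 - j) div 3 \<le> (2 + 3 * k) div 3" by (intro div_le_mono) linarith
  also have "\<dots> = k" by simp
  finally have "(m + 2 - j) div 3 \<le> k" .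
  then show ?thesis using True by (simp add: side_def)
qed (simp add: side_def)

lemma block_0: "block p 0 = {p}"
proof -
  have "p j \<le> z j \<and> z j < p j + 1 \<longleftrightarrow> z j = p j" for z j by auto
  then show ?thesis by (simp add: block_def side_0 set_eq_iff fun_eq_iff)
qed

lemma shift_block: "shift i n ` block p m = block (shift i n p) m"
proof (intro equalityI subsetI)
  fix z assume "z \<in> block (shift i n p) m"
  then have "shift i (- n) z \<in> block p m" by (auto simp: block_def shift_def split: if_splits)
  moreover have "z = shift i n (shift i (- n) z)" by (simp add: shift_def)
  ultimately show "z \<in> shift i n ` block p m" by blast
qed (auto simp: block_def shift_def)

lemma block_Suc:
  fixes p m defines "i \<equiv> m mod 3" defines "T \<equiv> shift i (int (side m i)) ` block p m"
  shows "block p (Suc m) = block p m \<union> T" "block p m \<inter> T = {}"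
proof -
  let ?s = "int (side m i)"
  have T: "z \<in> T \<longleftrightarrow> (\<forall>j. shift i ?s p j \<le> z j \<and> z j < shift i ?s p j + int (side m j))" for z
    unfolding T_def shift_block by (simp add: block_def)
  have Ti: "p i + ?s \<le> z i" "z i < p i + 2 * ?s" if "z \<in> T" for z
    using that[unfolded T, rule_format, of i] by (auto simp: shift_def)
  show "block p m \<inter> T = {}"
  proof (rule equals0I)
    fix z assume "z \<in> block p m \<inter> T"
    then have "z i < p i + ?s" "p i + ?s \<le> z i" using Ti(1) by (auto simp: block_def)
    then show False by simp
  qed
  show "block p (Suc m) = block p m \<union> T"
  proof (intro equalityI subsetI)
    fix z assume z: "z \<in> block p (Suc m)"
    have zz: "p j \<le> z j \<and> z j < p j + int (side (Suc m) j)" for j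
      using z by (simp add: block_def)
    have zj: "p j \<le> z j \<and> z j < p j + int (side m j)" if "j \<noteq> i" for j
      using zz[of j] that by (simp add: side_Suc i_def)
    have zi: "p i \<le> z i" "z i < p i + 2 * ?s"
      using zz[of i] by (simp_all add: side_Suc i_def)
    show "z \<in> block p m \<union> T"
    proof (cases "z i < p i + ?s")
      case True
      then have "z \<in> block p m" using zj zi by (auto simp: block_def) (metis)+
      then show ?thesis by simp
    next
      case False
      then have "z \<in> T" unfolding T using zj zi by (auto simp: shift_def)
      then show ?thesis by simp
    qed
  next
    fix z assume z: "z \<in> block p m \<union> T"
    have "p j \<le> z j \<and> z j < p j + int (side (Suc m) j)" for j
      using z
    proof
      assume "z \<in> block p m"
      then have "p j \<le> z j \<and> z j < p j + int (side m j)" by (simp add: block_def)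
      moreover have "side m j \<le> side (Suc m) j" by (simp add: side_Suc)
      ultimately show ?thesis by linarith
    next
      assume "z \<in> T"
      then have zj: "shift i ?s p j \<le> z j \<and> z j < shift i ?s p j + int (side m j)" unfolding T by blast
      show ?thesis
      proof (cases "j = i")
        case True
        then show ?thesis using zj by (simp add: shift_def side_Suc flip: i_def)
      next
        case False
        then show ?thesis using zj by (simp add: shift_def side_Suc flip: i_def)
      qed
    qed
    then show "z \<in> block p (Suc m)" by (simp add: block_def)
  qed
qed

lemma finite_card_block: "finite (block p m) \<and> card (block p m) = 2 ^ m"
proof (induction m)
  case (Suc m)
  then show ?case
    unfolding block_Suc(1) using block_Suc(2)[of p m]
    by (simp add: card_Un_disjoint card_image inj_shift)
qed (simp add: block_0)

lemma inj_wrap_block: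
  assumes L: "\<And>j. side m j \<le> L" and d: "3 \<le> d"
  shows "inj_on (wrap d L) (block p m)"
proof (intro inj_onI ext)
  fix x y j assume xy: "x \<in> block p m" "y \<in> block p m" and eq: "wrap d L x = wrap d L y"
  have r: "p j \<le> x j" "x j < p j + int (side m j)" "p j \<le> y j" "y j < p j + int (side m j)"
    using xy by (auto simp: block_def)
  show "x j = y j"
  proof (cases "j < d")
    case True
    then have "x j mod int L = y j mod int L" using fun_cong[OF eq, of j] by (simp add: wrap_def)
    then have "int L dvd x j - y j" by (simp add: mod_eq_dvd_iff)
    moreover have "\<bar>x j - y j\<bar> < int L" using r L[of j] by linarith
    ultimately show ?thesis using dvd_imp_le_int[of "x j - y j" "int L"] by fastforce
  next
    case False
    then have "side m j = 1" using d by (simp add: side_def)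
    then show ?thesis using r by simp
  qed
qed

section \<open>Summation over scales and long-range order\<close>

text \<open>
  The cost of doubling a block of \<open>2\<^sup>m\<close> sites: half a shift by \<open>2 ^ (m div 3)\<close>. It decays like
  \<open>2\<^sup>-\<^sup>m\<^sup>/\<^sup>6\<close>, so the costs of all scales are summable; with blocks that extend in two directions only
  they would not decay.
\<close>

definition scale_weight :: "nat \<Rightarrow> real" where
  "scale_weight m = 1 / 2 * (2 ^ (m div 3) / sqrt (2 ^ m))"

lemma sum_scale_weight_bounded: "\<exists>K>0. \<forall>m. (\<Sum>j<m. scale_weight j) \<le> K"
proof -
  define \<rho> :: real where "\<rho> = 2 powr (- 1 / 6)"
  have \<rho>: "0 < \<rho>" "\<rho> < 1" by (simp_all add: \<rho>_def powr_less_one)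
  have "scale_weight j \<le> \<rho> ^ j" for j
  proof -
    have "(2 :: real) ^ (j div 3) \<le> 2 powr (j / 3)"
    proof -
      have "real (j div 3) \<le> j / 3" by linarith
      then show ?thesis by (simp flip: powr_realpow)
    qed
    moreover have "sqrt (2 ^ j) = 2 powr (j / 2)"
      by (simp add: powr_powr flip: powr_half_sqrt powr_realpow)
    ultimately have "2 ^ (j div 3) / sqrt (2 ^ j) \<le> 2 powr (j / 3) / 2 powr (j / 2)"
      by (simp add: divide_right_mono)
    also have "\<dots> = \<rho> ^ j"
      by (simp add: \<rho>_def powr_powr flip: powr_diff powr_realpow)
    finally have "2 ^ (j div 3) / sqrt (2 ^ j) \<le> \<rho> ^ j" .
    moreover have "1 / 2 * a \<le> b" if "a \<le> b" "0 < b" for a b :: real using that by linarith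
    moreover have "0 < \<rho> ^ j" using \<rho>(1) by simp
    ultimately show ?thesis unfolding scale_weight_def by blast
  qed
  then have "(\<Sum>j<m. scale_weight j) \<le> (\<Sum>j<m. \<rho> ^ j)" for m by (intro sum_mono)
  also have "(\<Sum>j<m. \<rho> ^ j) \<le> 1 / (1 - \<rho>)" for m
    using \<rho> by (simp add: sum_gp_strict divide_right_mono)
  finally show ?thesis using \<rho> by (intro exI[of _ "1 / (1 - \<rho>)"]) auto
qed

context
  fixes d L k :: nat and \<beta> :: real
  assumes L: "even L" "2 \<le> L" and \<beta>: "0 < \<beta>" and d: "3 \<le> d"
    and k: "2 ^ k \<le> L" "L < 2 ^ Suc k"
begin

lemma inj_wrap_block_scale: "m \<le> 3 * k \<Longrightarrow> inj_on (wrap d L) (block p m)"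
  using side_le[of m k] k(1) by (intro inj_wrap_block d) (meson le_trans)

lemma block_nonempty: "block p m \<noteq> {}"
  using finite_card_block[of p m] by auto

lemma mean_square_le_block_Suc:
  assumes "m < 3 * k"
  shows "mean_square_le d L \<beta>
    (\<lambda>\<phi> :: 'n::finite spin_config. block_average d L (block p m) \<phi> - block_average d L (block p (Suc m)) \<phi>)
    (spin_wave_scale CARD('n) \<beta> * scale_weight m)"
proof -
  let ?S = "block p m" and ?i = "m mod 3" and ?\<sigma> = "spin_wave_scale CARD('n) \<beta>"
  let ?T = "shift ?i (int (side m ?i)) ` ?S"
  note S = conjunct1[OF finite_card_block] block_nonempty
  have "mean_square_le d L \<beta> (\<lambda>\<phi> :: 'n spin_config. block_average d L ?S \<phi> - block_average d L ?T \<phi>)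
      (2 ^ (m div 3) * (?\<sigma> / sqrt (card ?S)))"
    using mod_less_divisor[of 3 m] d assms
    by (intro mean_square_le_shift L \<beta> S inj_wrap_block_scale) (auto simp: side_doubled)
  then have "mean_square_le d L \<beta> (\<lambda>\<phi> :: 'n spin_config. (1 / 2) *\<^sub>R (block_average d L ?S \<phi> - block_average d L ?T \<phi>))
      (1 / 2 * (2 ^ (m div 3) * (?\<sigma> / sqrt (card ?S))))"
    using \<beta> by (intro mean_square_le_scaleR L) auto
  moreover have "1 / 2 * (2 ^ (m div 3) * (?\<sigma> / sqrt (card ?S))) = ?\<sigma> * scale_weight m"
    by (simp add: finite_card_block scale_weight_def)
  ultimately show ?thesis
    unfolding block_Suc(1) block_average_doubling[OF S block_Suc(2)] by simp
qed

lemma mean_square_le_block: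
  assumes "m \<le> 3 * k"
  shows "mean_square_le d L \<beta>
    (\<lambda>\<phi> :: 'n::finite spin_config. \<phi> (wrap d L p) - block_average d L (block p m) \<phi>)
    (spin_wave_scale CARD('n) \<beta> * (1 + (\<Sum>j<m. scale_weight j)))"
  using assms
proof (induction m)
  case 0
  show ?case using mean_square_le_zero[of L \<beta> d] L \<beta> by (simp add: block_0 block_average_def)
next
  case (Suc m)
  let ?\<sigma> = "spin_wave_scale CARD('n) \<beta>"
  have pos: "0 < scale_weight j" for j by (simp add: scale_weight_def)
  have \<sigma>: "0 < ?\<sigma>" using \<beta> by (intro spin_wave_scale_pos) simp_all
  have "0 < ?\<sigma> * (1 + (\<Sum>j<m. scale_weight j))"
    using \<sigma> pos by (intro mult_pos_pos add_pos_nonneg sum_nonneg) (auto intro: less_imp_le)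
  moreover have "0 < ?\<sigma> * scale_weight m" using \<sigma> pos by simp
  ultimately have "mean_square_le d L \<beta> (\<lambda>\<phi> :: 'n spin_config. (\<phi> (wrap d L p) - block_average d L (block p m) \<phi>)
      + (block_average d L (block p m) \<phi> - block_average d L (block p (Suc m)) \<phi>))
      (?\<sigma> * (1 + (\<Sum>j<m. scale_weight j)) + ?\<sigma> * scale_weight m)"
    using Suc \<beta> by (intro mean_square_le_add L mean_square_le_block_Suc) auto
  moreover have "?\<sigma> * (1 + (\<Sum>j<m. scale_weight j)) + ?\<sigma> * scale_weight m
      = ?\<sigma> * (1 + (\<Sum>j<Suc m. scale_weight j))" by (simp add: algebra_simps)
  ultimately show ?case by simp
qed

text \<open>
  At the largest scale the side of the block is comparable to \<open>L\<close>, so \<open>L\<close> unit shifts, each of order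
  \<open>L\<^sup>-\<^sup>3\<^sup>/\<^sup>2\<close>, stay bounded. The direction \<open>i\<close> may be one in which the block is only one site thick.
\<close>

lemma mean_square_le_macroscopic_shift:
  assumes i: "i < d" and n: "0 \<le> n" "n \<le> int L"
  shows "mean_square_le d L \<beta>
    (\<lambda>\<phi> :: 'n::finite spin_config. block_average d L (block p (3 * k)) \<phi>
       - block_average d L (block (shift i n p) (3 * k)) \<phi>)
    (2 * spin_wave_scale CARD('n) \<beta>)"
proof (rule mean_square_le_mono)
  let ?S = "block p (3 * k)" and ?\<sigma> = "spin_wave_scale CARD('n) \<beta>"
  have \<sigma>: "0 < ?\<sigma>" using \<beta> by (intro spin_wave_scale_pos) simp_all
  note S = conjunct1[OF finite_card_block] block_nonempty
  show "mean_square_le d L \<beta>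
    (\<lambda>\<phi> :: 'n spin_config. block_average d L ?S \<phi> - block_average d L (block (shift i n p) (3 * k)) \<phi>)
    (L * (?\<sigma> / sqrt (card ?S)))"
    unfolding shift_block[symmetric]
    using n by (intro mean_square_le_shift L \<beta> S inj_wrap_block_scale i) auto
  show "0 \<le> L * (?\<sigma> / sqrt (card ?S))" using \<sigma> by simp
  have "(2 ^ k)\<^sup>2 \<le> (2 :: real) ^ (3 * k)"
    by (simp flip: power_mult)
  then have "(2 :: real) ^ k \<le> sqrt (card ?S)"
    unfolding conjunct2[OF finite_card_block] by (intro real_le_rsqrt) simp
  moreover have "real L \<le> 2 * 2 ^ k"
  proof -
    have "real L \<le> real (2 ^ Suc k)" using k(2) by (intro of_nat_mono) simp
    then show ?thesis by simp
  qed
  ultimately have "real L \<le> 2 * sqrt (card ?S)" by linarith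
  moreover have "0 < sqrt (card ?S)" by (simp add: finite_card_block)
  ultimately show "L * (?\<sigma> / sqrt (card ?S)) \<le> 2 * ?\<sigma>"
    using \<sigma> by (simp add: pos_divide_le_eq)
qed

text \<open>
  The block is moved from the origin to \<open>w\<close> one coordinate at a time.
\<close>

lemma mean_square_le_translated_block:
  assumes w: "w \<in> torus d L" and "j \<le> d"
  shows "mean_square_le d L \<beta>
    (\<lambda>\<phi> :: 'n::finite spin_config. block_average d L (block (\<lambda>_. 0) (3 * k)) \<phi>
       - block_average d L (block (\<lambda>i. if i < j then w i else 0) (3 * k)) \<phi>)
    (spin_wave_scale CARD('n) \<beta> * (1 + 2 * real j))"
  using \<open>j \<le> d\<close>
proof (induction j)
  case 0
  show ?case using mean_square_le_zero[of L \<beta> d] L \<beta> by simp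
next
  case (Suc j)
  let ?\<sigma> = "spin_wave_scale CARD('n) \<beta>" and ?P = "\<lambda>j i. if i < j then w i else 0"
  have \<sigma>: "0 < ?\<sigma>" using \<beta> by (intro spin_wave_scale_pos) simp_all
  have P: "?P (Suc j) = shift j (w j) (?P j)"
    by (auto simp: shift_def fun_eq_iff less_Suc_eq)
  have "w j \<in> {0..<int L}"
    using PiE_mem[OF w[unfolded torus_def], of j] Suc.prems by simp
  then have wj: "0 \<le> w j" "w j \<le> int L" by auto
  have jd: "j < d" using Suc.prems by simp
  have "mean_square_le d L \<beta> (\<lambda>\<phi> :: 'n spin_config.
      block_average d L (block (?P j) (3 * k)) \<phi> - block_average d L (block (?P (Suc j)) (3 * k)) \<phi>) (2 * ?\<sigma>)"
    unfolding P by (rule mean_square_le_macroscopic_shift[OF jd wj])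
  moreover have "0 < ?\<sigma> * (1 + 2 * real j)" "0 < 2 * ?\<sigma>" using \<sigma> by simp_all
  ultimately have "mean_square_le d L \<beta> (\<lambda>\<phi> :: 'n spin_config.
      (block_average d L (block (\<lambda>_. 0) (3 * k)) \<phi> - block_average d L (block (?P j) (3 * k)) \<phi>)
      + (block_average d L (block (?P j) (3 * k)) \<phi> - block_average d L (block (?P (Suc j)) (3 * k)) \<phi>))
      (?\<sigma> * (1 + 2 * real j) + 2 * ?\<sigma>)"
    using mean_square_le_add[OF L(2) less_imp_le[OF \<beta>] Suc.IH[OF less_imp_le[OF jd]]] by blast
  moreover have "?\<sigma> * (1 + 2 * real j) + 2 * ?\<sigma> = ?\<sigma> * (1 + 2 * real (Suc j))" by (simp add: algebra_simps)
  ultimately show ?case by simp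
qed

end

text \<open>
  Compare the spin at the origin with the average over the largest block there, this average with its
  translate at \<open>w\<close>, and the translate with the spin at \<open>w\<close>.
\<close>

lemma spin_difference_mean_square:
  assumes d: "3 \<le> d"
  shows "\<exists>K>0. \<forall>\<beta>>0. \<forall>L\<ge>2. even L \<longrightarrow> (\<forall>w\<in>torus d L.
    mean_square_le d L \<beta> (\<lambda>\<phi> :: 'n::finite spin_config. \<phi> (origin d) - \<phi> w) (spin_wave_scale CARD('n) \<beta> * K))"
proof -
  obtain K0 where K0: "0 < K0" "\<And>m. (\<Sum>j<m. scale_weight j) \<le> K0"
    using sum_scale_weight_bounded by blast
  define K where "K = (1 + K0) + (1 + 2 * real d) + (1 + K0)"
  have "mean_square_le d L \<beta> (\<lambda>\<phi> :: 'n spin_config. \<phi> (origin d) - \<phi> w) (spin_wave_scale CARD('n) \<beta> * K)"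
    if \<beta>: "0 < \<beta>" and L: "even L" "2 \<le> L" and w: "w \<in> torus d L" for \<beta> L w
  proof -
    let ?\<sigma> = "spin_wave_scale CARD('n) \<beta>"
    have \<sigma>: "0 < ?\<sigma>" using \<beta> by (intro spin_wave_scale_pos) simp_all
    obtain k where k: "2 ^ k \<le> L" "L < 2 ^ Suc k"
      using ex_power_ivl1[of 2 L] L by auto
    let ?B = "\<lambda>p. block_average d L (block p (3 * k)) :: 'n spin_config \<Rightarrow> _"
    let ?w = "\<lambda>i. if i < d then w i else 0"
    have near: "mean_square_le d L \<beta> (\<lambda>\<phi> :: 'n spin_config. \<phi> (wrap d L p) - ?B p \<phi>) (?\<sigma> * (1 + K0))" for p
    proof (rule mean_square_le_mono[OF mean_square_le_block[OF L \<beta> d k order_refl]])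
      have nonneg: "0 \<le> (\<Sum>j<3 * k. scale_weight j)" by (intro sum_nonneg) (simp add: scale_weight_def)
      show "0 \<le> ?\<sigma> * (1 + (\<Sum>j<3 * k. scale_weight j))" using \<sigma> nonneg by simp
      show "?\<sigma> * (1 + (\<Sum>j<3 * k. scale_weight j)) \<le> ?\<sigma> * (1 + K0)"
        using \<sigma> K0(2) by simp
    qed
    have wo: "wrap d L (\<lambda>_. 0) = origin d" by (simp add: wrap_def origin_def)
    have ww: "wrap d L ?w = w"
    proof -
      have "wrap d L ?w = wrap d L w" by (auto simp: wrap_def fun_eq_iff)
      then show ?thesis using wrap_torus[OF w] by simp
    qed
    have far: "mean_square_le d L \<beta> (\<lambda>\<phi> :: 'n spin_config. ?B (\<lambda>_. 0) \<phi> - ?B ?w \<phi>) (?\<sigma> * (1 + 2 * real d))"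
      using mean_square_le_translated_block[OF L \<beta> d k w order_refl] by simp
    have near': "mean_square_le d L \<beta> (\<lambda>\<phi> :: 'n spin_config. ?B ?w \<phi> - \<phi> w) (?\<sigma> * (1 + K0))"
    proof -
      have "mean_square_le d L \<beta> (\<lambda>\<phi> :: 'n spin_config. (-1) *\<^sub>R (\<phi> w - ?B ?w \<phi>)) (-1 * (?\<sigma> * (1 + K0)))"
        using near[of ?w] \<beta> unfolding ww by (intro mean_square_le_scaleR L) auto
      then show ?thesis by (simp add: mean_square_le_def)
    qed
    have pos: "0 < ?\<sigma> * (1 + K0)" "0 < ?\<sigma> * (1 + 2 * real d)" using \<sigma> K0(1) by simp_all
    have "mean_square_le d L \<beta> (\<lambda>\<phi> :: 'n spin_config. (\<phi> (origin d) - ?B (\<lambda>_. 0) \<phi>) + (?B (\<lambda>_. 0) \<phi> - ?B ?w \<phi>)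
        + (?B ?w \<phi> - \<phi> w)) (?\<sigma> * (1 + K0) + ?\<sigma> * (1 + 2 * real d) + ?\<sigma> * (1 + K0))"
      using mean_square_le_add[OF L(2) less_imp_le[OF \<beta>]
          mean_square_le_add[OF L(2) less_imp_le[OF \<beta>] near[of "\<lambda>_. 0", unfolded wo] far pos]
          near' add_pos_pos[OF pos] pos(1)] .
    moreover have "?\<sigma> * (1 + K0) + ?\<sigma> * (1 + 2 * real d) + ?\<sigma> * (1 + K0) = ?\<sigma> * K"
      by (simp only: K_def distrib_left)
    ultimately show ?thesis by simp
  qed
  moreover have "0 < K" using K0(1) by (simp add: K_def)
  ultimately show ?thesis by blast
qed

lemma spin_difference_expectation:
  assumes L: "2 \<le> L" and \<beta>: "0 \<le> \<beta>" and xy: "x \<in> torus d L" "y \<in> torus d L"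
  shows "spin_expectation d L \<beta> (\<lambda>\<phi> :: 'n::finite spin_config. \<phi> x \<bullet> \<phi> y)
    = 1 - spin_expectation d L \<beta> (\<lambda>\<phi> :: 'n spin_config. (norm (\<phi> x - \<phi> y))\<^sup>2) / 2"
proof -
  note bo = bounded_observable_spin[OF xy(1), where 'n = 'n] bounded_observable_spin[OF xy(2), where 'n = 'n]
  let ?D = "\<lambda>\<phi> :: 'n spin_config. (norm (\<phi> x - \<phi> y))\<^sup>2"
  have boD: "bounded_observable d L ?D" by (intro bounded_observable_norm_square bounded_observable_diff bo)
  have boI: "bounded_observable d L (\<lambda>\<phi> :: 'n spin_config. \<phi> x \<bullet> \<phi> y)" by (intro bounded_observable_inner bo)
  have bo1: "bounded_observable d L (\<lambda>_ :: 'n spin_config. 1 :: real)" by (auto simp: bounded_observable_def)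
  have bor: "bounded_observable d L (\<lambda>\<phi>. 1 * 1 + (- 1 / 2) * ?D \<phi>)"
    unfolding real_scaleR_def[symmetric] by (intro bounded_observable_add bounded_observable_scaleR boD bo1)
  have eq: "\<phi> x \<bullet> \<phi> y = 1 * 1 + (- 1 / 2) * ?D \<phi>" if "\<phi> \<in> space (spin_measure d L)" for \<phi> :: "'n spin_config"
    using norm_spin[OF that] xy by (simp add: power2_norm_eq_inner inner_diff inner_commute norm_eq_1 field_simps)
  have "spin_expectation d L \<beta> (\<lambda>\<phi> :: 'n spin_config. \<phi> x \<bullet> \<phi> y) = spin_expectation d L \<beta> (\<lambda>\<phi>. 1 * 1 + (- 1 / 2) * ?D \<phi>)"
    using eq by (intro antisym spin_expectation_mono[OF L \<beta>] boI bor) simp_all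
  also have "\<dots> = 1 * spin_expectation d L \<beta> (\<lambda>_ :: 'n spin_config. 1) + (- 1 / 2) * spin_expectation d L \<beta> ?D"
    by (rule spin_expectation_lincomb[OF L \<beta> bo1 boD])
  finally show ?thesis by (simp add: spin_expectation_const[OF L \<beta>])
qed

theorem theorem2p8:
  fixes d :: nat
  assumes "d \<ge> 3"
  shows "\<exists>\<beta>0 :: real. \<forall>\<beta>>\<beta>0. \<exists>C>0. \<exists>L0 :: nat. \<forall>L>L0. even L \<longrightarrow>
    (\<forall>z\<in>torus d L. real_of_int (torus_norm d L z) < real L / 8 \<longrightarrow>
       spin_expectation d L \<beta> (\<lambda>\<phi> :: 'n::finite spin_config. \<phi> (origin d) \<bullet> \<phi> z) \<ge> C)"
proof -
  obtain K where "0 < K" and K: "\<forall>\<beta>>0. \<forall>L\<ge>2. even L \<longrightarrow> (\<forall>z\<in>torus d L.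
      mean_square_le d L \<beta> (\<lambda>\<phi> :: 'n spin_config. \<phi> (origin d) - \<phi> z) (spin_wave_scale CARD('n) \<beta> * K))"
    using spin_difference_mean_square[OF assms, where 'n = 'n] by (elim exE conjE) (rule that)
  define \<beta>0 where "\<beta>0 = 4 * CARD('n) * K\<^sup>2"
  have "0 \<le> \<beta>0" by (simp add: \<beta>0_def)
  have "1 / 2 \<le> spin_expectation d L \<beta> (\<lambda>\<phi> :: 'n spin_config. \<phi> (origin d) \<bullet> \<phi> z)"
    if \<beta>: "\<beta>0 < \<beta>" and L: "1 < L" "even L" and z: "z \<in> torus d L" for \<beta> L z
  proof -
    have \<beta>': "0 < \<beta>" and L': "2 \<le> L" using \<beta> \<open>0 \<le> \<beta>0\<close> L by auto
    have o: "origin d \<in> torus d L" using L by (simp add: origin_def torus_def)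
    have "(spin_wave_scale CARD('n) \<beta> * K)\<^sup>2 = \<beta>0 / \<beta>"
      using \<beta>' by (simp add: spin_wave_scale_def \<beta>0_def power_mult_distrib)
    also have "\<dots> \<le> 1" using \<beta> \<beta>' by simp
    finally have "spin_expectation d L \<beta> (\<lambda>\<phi> :: 'n spin_config. (norm (\<phi> (origin d) - \<phi> z))\<^sup>2) \<le> 1"
      using K[rule_format, OF \<beta>' L' L(2) z] by (simp add: mean_square_le_def)
    then show ?thesis
      using spin_difference_expectation[OF L' less_imp_le[OF \<beta>'] o z, where 'n = 'n] by simp
  qed
  then show ?thesis
    by (intro exI[of _ \<beta>0] allI impI exI[of _ "1 / 2"] conjI exI[of _ "1 :: nat"] ballI) simp_all
qed

end
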